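(* Let $V$ be a vertex algebra, $\varphi$ a locally finite automorphism of $V$, written $\varphi=\sigma e^{-2\pi\mathrm i\mathcal N}$ with $\sigma\in\mathrm{Aut}(V)$ semisimple, $\mathcal N\in\mathrm{Der}(V)$ locally nilpotent and $\sigma\mathcal N=\mathcal N\sigma$. Let $W$ be a vector space and $Y\colon V\to\mathrm{LFie}(W)$ a linear map satisfying the $\varphi$-equivariance $Y(\varphi a,z)=e^{2\pi\mathrm iD_\zeta}Y(a,z)$ for all $a\in V$, and the Borcherds identity $$\iota_{z_1,z_2}z_{12}^n\,Y(a,z_1)Y(b,z_2)v-\iota_{z_2,z_1}z_{12}^n\,Y(b,z_2)Y(a,z_1)v=\sum_{j=0}^\infty Y\Bigl(\bigl(D_{z_2}^{(j)}\delta_{\alpha+\mathcal N}(z_1,z_2)a\bigr)_{(n+j)}b,\,z_2\Bigr)v$$ for all $\alpha\in\mathbb C/\mathbb Z$, $a\in V_\alpha$, $b\in V$, $v\in W$ and $n\in\mathbb Z$. Then $W$ (with the map $Y$) is a $\varphi$-twisted $V$-module.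
   Context: All vector spaces are over $\mathbb C$, $\mathrm i=\sqrt{-1}$; $x^{(k)}=x^k/k!$, in particular $D^{(k)}=D^k/k!$ for an operator $D$. $z,z_1,z_2,\dots$ are commuting formal variables, $\zeta,\zeta_1,\zeta_2,\dots$ are further formal variables (thought of as $\zeta=\log z$, $\zeta_i=\log z_i$), and $z_{ij}=z_i-z_j$. Put $D_z=\partial_z+z^{-1}\partial_\zeta$, $D_\zeta=z\partial_z+\partial_\zeta$, and similarly $D_{z_i},D_{\zeta_i}$. Logarithmic fields. For a vector space $W$ and $\alpha\in\mathbb C/\mathbb Z$, $W[\zeta][[z]]z^{-\alpha}$ is the space of formal series $\sum_{i\ge0}w_i(\zeta)z^{i-m}$ with $w_i(\zeta)\in W[\zeta]$, $m\in\alpha$. Let $\mathrm{LFie}_\alpha(W)=\mathrm{Hom}_{\mathbb C}(W,W[\zeta][[z]]z^{-\alpha})$ and $\mathrm{LFie}(W)=\bigoplus_{\alpha\in\mathbb C/\mathbb Z}\mathrm{LFie}_\alpha(W)$; its elements, written $a(z)$ or $a(\zeta,z)$, are called logarithmic fields. Two logarithmic fields $a,b$ are local if $z_{12}^N a(z_1)b(z_2)=z_{12}^N b(z_2)a(z_1)$ for some integer $N\ge0$. For local $a,b$ and $n\in\mathbb Z$, the $n$-th product is the logarithmic field given by $(a_{(n)}b)(z)v=D_{z_1}^{(N-1-n)}\bigl(z_{12}^N a(z_1)b(z_2)v\bigr)\big|_{z_1=z_2=z,\ \zeta_1=\zeta_2=\zeta}$ ($v\in W$) for $n\le N-1$, and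 $a_{(n)}b=0$ for $n\ge N$ (independent of the choice of $N$). A local collection is a set of logarithmic fields in which every pair is local. Twisted modules. $V$ has a vacuum vector $\mathbf 1$ and products $a_{(n)}b$ ($a,b\in V$, $n\in\mathbb Z$). $\mathrm{Aut}(V)$ (resp. $\mathrm{Der}(V)$) is the set of invertible linear maps preserving all $n$-th products (resp. linear maps that are derivations of all $n$-th products). For $\varphi\in\mathrm{Aut}(V)$, a $\varphi$-twisted $V$-module is a vector space $W$ with a linear map $Y\colon V\to\mathrm{LFie}(W)$, $a\mapsto Y(a,z)$, such that $Y(\mathbf 1)=I$ is the identity operator, $Y(V)$ is a local collection, $Y(\varphi a,z)=e^{2\pi\mathrm iD_\zeta}Y(a,z)$, and $Y(a_{(n)}b,z)=Y(a,z)_{(n)}Y(b,z)$ for all $a,b\in V$, $n\in\mathbb Z$. Here $e^{2\pi\mathrm iD_\zeta}$ sends $\zeta\mapsto\zeta+2\pi\mathrm i$ and $z^\gamma\mapsto e^{2\pi\mathrm i\gamma}z^\gamma$. Local finiteness. $\varphi$ is locally finite if every $a\in V$ lies in a finite-dimensional $\varphi$-invariant subspace; such an automorphism has a unique decomposition $\varphi=\sigma e^{-2\pi\mathrm i\mathcal N}$ as in the claim, where locally nilpotent means that for every $a\in V$ one has $\mathcal N^l a=0$ for some $l\ge1$. For $\alpha\in\mathbb C/\mathbb Z$, $V_\alpha=\{a\in V\mid\sigma a=e^{-2\pi\mathrm i\alpha}a\}$. Put $z_i^{m+\mathcal N}a=z_i^me^{\zeta_i\mathcal N}a$, and extend $Y$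 and the $n$-th products of $V$ linearly over expressions in the formal variables. Shifted delta function: $\delta_{\alpha+\mathcal N}(z_1,z_2)=\sum_{m\in\alpha}z_1^{-m-1-\mathcal N}z_2^{m+\mathcal N}=\sum_{m\in\alpha}z_1^{-m-1}z_2^{m}\,e^{(\zeta_2-\zeta_1)\mathcal N}$, so that $D_{z_2}^{(j)}\delta_{\alpha+\mathcal N}(z_1,z_2)a=\sum_{m\in\alpha}z_1^{-m-1-\mathcal N}z_2^{m-j+\mathcal N}\binom{m+\mathcal N}{j}a$, where $\binom{m+\mathcal N}{j}=\frac1{j!}(m+\mathcal N)\cdots(m+\mathcal N-j+1)$. Expansions: $\iota_{z_1,z_2}z_{12}^n=\sum_{i\ge0}\binom ni(-1)^iz_1^{n-i}z_2^i$ and $\iota_{z_2,z_1}z_{12}^n=\sum_{i\ge0}\binom ni(-1)^{n+i}z_1^iz_2^{n-i}$.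
   Formalization: The vacuum condition Y(1)=I is added as a hypothesis: without it the claim fails, since Y=0 on a nonzero W is linear, φ-equivariant and satisfies the Borcherds identity but is not a twisted module. *)

theory Defs
  imports Complex_Main "HOL-Library.Groups_Big_Fun"
begin

text \<open>
  A complex vector space is a type of class \<^class>\<open>ab_group_add\<close> with a scaling
  \<open>s\<close> such that \<open>vector_space s\<close>.  \<^const>\<open>Sum_any\<close> is the sum over a whole type; it
  is only meant for finitely supported summands (and is \<open>0\<close> otherwise).  In every use
  below the support is finite whenever the corresponding formal expression makes sense.
\<close>


section \<open>Vertex algebras\<close>

text \<open>\<open>pr a n b\<close> is the product \<open>a\<^sub>(\<^sub>n\<^sub>)b\<close>.\<close>

locale vertex_algebra = vector_space s
  for s :: "complex \<Rightarrow> 'v::ab_group_add \<Rightarrow> 'v" +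
  fixes vac :: 'v
    and pr :: "'v \<Rightarrow> int \<Rightarrow> 'v \<Rightarrow> 'v"
  assumes pr_linear_left: "Vector_Spaces.linear s s (\<lambda>a. pr a n b)"
    and pr_linear_right: "Vector_Spaces.linear s s (\<lambda>b. pr a n b)"
    and pr_truncation: "\<exists>N. \<forall>n\<ge>N. pr a n b = 0"
    and vac_left: "pr vac n a = (if n = -1 then a else 0)"
    and vac_right: "pr a (-1) vac = a" "n \<ge> 0 \<Longrightarrow> pr a n vac = 0"
    and borcherds:
      "Sum_any (\<lambda>j. s (of_int m gchoose j) (pr (pr a (n + int j) b) (m + k - int j) c)) =
       Sum_any (\<lambda>j. s ((-1) ^ j * (of_int n gchoose j))
          (pr a (m + n - int j) (pr b (k + int j) c)
             - s ((-1) powi n) (pr b (n + k - int j) (pr a (m + int j) c))))"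

definition Aut_VA ::
  "(complex \<Rightarrow> 'v::ab_group_add \<Rightarrow> 'v) \<Rightarrow> ('v \<Rightarrow> int \<Rightarrow> 'v \<Rightarrow> 'v) \<Rightarrow> ('v \<Rightarrow> 'v) set" where
  "Aut_VA s pr = {f. Vector_Spaces.linear s s f \<and> bij f \<and>
     (\<forall>a n b. f (pr a n b) = pr (f a) n (f b))}"

definition Der_VA ::
  "(complex \<Rightarrow> 'v::ab_group_add \<Rightarrow> 'v) \<Rightarrow> ('v \<Rightarrow> int \<Rightarrow> 'v \<Rightarrow> 'v) \<Rightarrow> ('v \<Rightarrow> 'v) set" where
  "Der_VA s pr = {d. Vector_Spaces.linear s s d \<and>
     (\<forall>a n b. d (pr a n b) = pr (d a) n b + pr a n (d b))}"

definition locally_finite :: "(complex \<Rightarrow> 'v::ab_group_add \<Rightarrow> 'v) \<Rightarrow> ('v \<Rightarrow> 'v) \<Rightarrow> bool" where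
  "locally_finite s f \<longleftrightarrow> (\<forall>a. \<exists>U. a \<in> U \<and> f ` U \<subseteq> U \<and> (\<exists>B. finite B \<and> U = module.span s B))"

definition locally_nilpotent :: "('v::zero \<Rightarrow> 'v) \<Rightarrow> bool" where
  "locally_nilpotent f \<longleftrightarrow> (\<forall>a. \<exists>l\<ge>1. (f ^^ l) a = 0)"

text \<open>Over the complex numbers, semisimple means diagonalizable, i.e. the space is spanned by
  eigenvectors (eigenspaces for distinct eigenvalues are automatically independent).\<close>

definition semisimple_op :: "(complex \<Rightarrow> 'v::ab_group_add \<Rightarrow> 'v) \<Rightarrow> ('v \<Rightarrow> 'v) \<Rightarrow> bool" where
  "semisimple_op s f \<longleftrightarrow> module.span s {a. \<exists>c. f a = s c a} = UNIV"

text \<open>\<open>e\<^bsup>cf\<^esup>\<close>, for locally nilpotent \<open>f\<close>.\<close>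

definition exp_op ::
  "(complex \<Rightarrow> 'v::ab_group_add \<Rightarrow> 'v) \<Rightarrow> complex \<Rightarrow> ('v \<Rightarrow> 'v) \<Rightarrow> 'v \<Rightarrow> 'v" where
  "exp_op s c f a = Sum_any (\<lambda>k. s (c ^ k / fact k) ((f ^^ k) a))"

definition CmodZ :: "complex set set" where
  "CmodZ = UNIV // {(x, y). x - y \<in> \<int>}"

definition eigen_component ::
  "(complex \<Rightarrow> 'v \<Rightarrow> 'v) \<Rightarrow> ('v \<Rightarrow> 'v) \<Rightarrow> complex set \<Rightarrow> 'v set" where
  "eigen_component s \<sigma> \<alpha> = {a. \<forall>m\<in>\<alpha>. \<sigma> a = s (exp (- 2 * of_real pi * \<i> * m)) a}"


section \<open>Formal series\<close>

text \<open>\<open>f p k\<close> is the coefficient of \<open>z\<^sup>p\<zeta>\<^sup>k\<close>, and \<open>F p k q l\<close> is the coefficient of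
  \<open>z\<^sub>1\<^sup>p\<zeta>\<^sub>1\<^sup>kz\<^sub>2\<^sup>q\<zeta>\<^sub>2\<^sup>l\<close>.\<close>

type_synonym 'w ser = "complex \<Rightarrow> nat \<Rightarrow> 'w"
type_synonym 'w ser2 = "complex \<Rightarrow> nat \<Rightarrow> complex \<Rightarrow> nat \<Rightarrow> 'w"

text \<open>The space \<open>W[\<zeta>][[z]]z\<^sup>-\<^sup>\<alpha>\<close>.\<close>

definition log_series :: "complex set \<Rightarrow> ('w::zero ser) set" where
  "log_series \<alpha> = {f. (\<forall>\<gamma>. finite {k. f \<gamma> k \<noteq> 0}) \<and>
     (\<exists>m\<in>\<alpha>. \<forall>\<gamma> k. f \<gamma> k \<noteq> 0 \<longrightarrow> (\<exists>i::nat. \<gamma> = of_nat i - m))}"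

text \<open>\<open>e\<^bsup>2\<pi>iD\<^esup>\<close> with \<open>D = D\<^sub>\<zeta>\<close>: substitute \<open>\<zeta> + 2\<pi>i\<close> for \<open>\<zeta>\<close> and multiply
  \<open>z\<^sup>\<gamma>\<close> by \<open>e\<^bsup>2\<pi>i\<gamma>\<^esup>\<close>.  The terms with \<open>l < k\<close> vanish because \<open>l choose k = 0\<close>.\<close>

definition monodromy :: "(complex \<Rightarrow> 'w::ab_group_add \<Rightarrow> 'w) \<Rightarrow> 'w ser \<Rightarrow> 'w ser" where
  "monodromy s f = (\<lambda>\<gamma> k. s (exp (2 * of_real pi * \<i> * \<gamma>))
     (Sum_any (\<lambda>l. s (of_nat (l choose k) * (2 * of_real pi * \<i>) ^ (l - k)) (f \<gamma> l))))"

text \<open>\<open>D = \<partial>\<^sub>z + z\<^sup>-\<^sup>1\<partial>\<^sub>\<zeta>\<close> in the first and in the second pair of variables.\<close>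

definition D_z1 :: "(complex \<Rightarrow> 'w::plus \<Rightarrow> 'w) \<Rightarrow> 'w ser2 \<Rightarrow> 'w ser2" where
  "D_z1 s F = (\<lambda>\<gamma>1 k1 \<gamma>2 k2.
     s (\<gamma>1 + 1) (F (\<gamma>1 + 1) k1 \<gamma>2 k2) + s (of_nat (Suc k1)) (F (\<gamma>1 + 1) (Suc k1) \<gamma>2 k2))"

definition D_z2 :: "(complex \<Rightarrow> 'w::plus \<Rightarrow> 'w) \<Rightarrow> 'w ser2 \<Rightarrow> 'w ser2" where
  "D_z2 s F = (\<lambda>\<gamma>1 k1 \<gamma>2 k2.
     s (\<gamma>2 + 1) (F \<gamma>1 k1 (\<gamma>2 + 1) k2) + s (of_nat (Suc k2)) (F \<gamma>1 k1 (\<gamma>2 + 1) (Suc k2)))"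

text \<open>\<open>T\<^sup>(\<^sup>j\<^sup>) = T\<^sup>j / j!\<close>\<close>

definition divided_power ::
  "(complex \<Rightarrow> 'w \<Rightarrow> 'w) \<Rightarrow> ('w ser2 \<Rightarrow> 'w ser2) \<Rightarrow> nat \<Rightarrow> 'w ser2 \<Rightarrow> 'w ser2" where
  "divided_power s T j F = (\<lambda>\<gamma>1 k1 \<gamma>2 k2. s (1 / fact j) ((T ^^ j) F \<gamma>1 k1 \<gamma>2 k2))"

text \<open>Multiplication by \<open>z\<^sub>1\<^sub>2 = z\<^sub>1 - z\<^sub>2\<close>, and by the two expansions of \<open>z\<^sub>1\<^sub>2\<^sup>n\<close>.\<close>

definition mult_z12 :: "'w::minus ser2 \<Rightarrow> 'w ser2" where
  "mult_z12 F = (\<lambda>\<gamma>1 k1 \<gamma>2 k2. F (\<gamma>1 - 1) k1 \<gamma>2 k2 - F \<gamma>1 k1 (\<gamma>2 - 1) k2)"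

definition mult_iota12 ::
  "(complex \<Rightarrow> 'w::ab_group_add \<Rightarrow> 'w) \<Rightarrow> int \<Rightarrow> 'w ser2 \<Rightarrow> 'w ser2" where
  "mult_iota12 s n F = (\<lambda>\<gamma>1 k1 \<gamma>2 k2. Sum_any (\<lambda>i::nat.
     s ((of_int n gchoose i) * (-1) ^ i)
       (F (\<gamma>1 - (of_int n - of_nat i)) k1 (\<gamma>2 - of_nat i) k2)))"

definition mult_iota21 ::
  "(complex \<Rightarrow> 'w::ab_group_add \<Rightarrow> 'w) \<Rightarrow> int \<Rightarrow> 'w ser2 \<Rightarrow> 'w ser2" where
  "mult_iota21 s n F = (\<lambda>\<gamma>1 k1 \<gamma>2 k2. Sum_any (\<lambda>i::nat.
     s ((of_int n gchoose i) * (-1) powi (n + int i))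
       (F (\<gamma>1 - of_nat i) k1 (\<gamma>2 - (of_int n - of_nat i)) k2)))"

text \<open>Restriction to \<open>z\<^sub>1 = z\<^sub>2 = z\<close>, \<open>\<zeta>\<^sub>1 = \<zeta>\<^sub>2 = \<zeta>\<close>.\<close>

definition diagonal :: "'w::comm_monoid_add ser2 \<Rightarrow> 'w ser" where
  "diagonal F = (\<lambda>\<gamma> k. Sum_any (\<lambda>\<gamma>1. \<Sum>k1\<le>k. F \<gamma>1 k1 (\<gamma> - \<gamma>1) (k - k1)))"


section \<open>Logarithmic fields\<close>

text \<open>A field \<open>a\<close> is the map \<open>v \<mapsto> a(z)v\<close>.\<close>

type_synonym 'w lfield = "'w \<Rightarrow> 'w ser"

definition LFie_comp ::
  "(complex \<Rightarrow> 'w::ab_group_add \<Rightarrow> 'w) \<Rightarrow> complex set \<Rightarrow> 'w lfield set" where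
  "LFie_comp s \<alpha> = {a. (\<forall>v. a v \<in> log_series \<alpha>) \<and>
     (\<forall>\<gamma> k. Vector_Spaces.linear s s (\<lambda>v. a v \<gamma> k))}"

text \<open>The sum of the spaces \<^const>\<open>LFie_comp\<close> is direct, since distinct cosets give
  disjoint sets of exponents.\<close>

definition LFie :: "(complex \<Rightarrow> 'w::ab_group_add \<Rightarrow> 'w) \<Rightarrow> 'w lfield set" where
  "LFie s = {a. \<exists>A f. finite A \<and> A \<subseteq> CmodZ \<and> (\<forall>\<alpha>\<in>A. f \<alpha> \<in> LFie_comp s \<alpha>) \<and>
     a = (\<lambda>v \<gamma> k. \<Sum>\<alpha>\<in>A. f \<alpha> v \<gamma> k)}"

definition id_field :: "'w::zero lfield" where
  "id_field v = (\<lambda>\<gamma> k. if \<gamma> = 0 \<and> k = 0 then v else 0)"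

text \<open>\<open>a(z\<^sub>1)b(z\<^sub>2)v\<close> and \<open>b(z\<^sub>2)a(z\<^sub>1)v\<close>\<close>

definition comp12 :: "'w lfield \<Rightarrow> 'w lfield \<Rightarrow> 'w \<Rightarrow> 'w ser2" where
  "comp12 a b v = (\<lambda>\<gamma>1 k1 \<gamma>2 k2. a (b v \<gamma>2 k2) \<gamma>1 k1)"

definition comp21 :: "'w lfield \<Rightarrow> 'w lfield \<Rightarrow> 'w \<Rightarrow> 'w ser2" where
  "comp21 b a v = (\<lambda>\<gamma>1 k1 \<gamma>2 k2. b (a v \<gamma>1 k1) \<gamma>2 k2)"

definition local_of_order :: "nat \<Rightarrow> 'w::minus lfield \<Rightarrow> 'w lfield \<Rightarrow> bool" where
  "local_of_order N a b \<longleftrightarrow>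
     (\<forall>v. (mult_z12 ^^ N) (comp12 a b v) = (mult_z12 ^^ N) (comp21 b a v))"

definition local_pair :: "'w::minus lfield \<Rightarrow> 'w lfield \<Rightarrow> bool" where
  "local_pair a b \<longleftrightarrow> (\<exists>N. local_of_order N a b)"

definition local_collection ::
  "(complex \<Rightarrow> 'w::ab_group_add \<Rightarrow> 'w) \<Rightarrow> 'w lfield set \<Rightarrow> bool" where
  "local_collection s C \<longleftrightarrow> C \<subseteq> LFie s \<and> (\<forall>a\<in>C. \<forall>b\<in>C. local_pair a b)"

text \<open>The \<open>n\<close>-th product of local logarithmic fields.  It does not depend on the order of
  locality \<open>N\<close> used to compute it; the least one is taken.\<close>

definition lprod ::
  "(complex \<Rightarrow> 'w::ab_group_add \<Rightarrow> 'w) \<Rightarrow> 'w lfield \<Rightarrow> int \<Rightarrow> 'w lfield \<Rightarrow> 'w lfield" where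
  "lprod s a n b = (let N = (LEAST N. local_of_order N a b) in
     (\<lambda>v. if n \<le> int N - 1
        then diagonal (divided_power s (D_z1 s) (nat (int N - 1 - n))
               ((mult_z12 ^^ N) (comp12 a b v)))
        else (\<lambda>\<gamma> k. 0)))"


section \<open>Twisted modules\<close>

definition linear_to_LFie ::
  "(complex \<Rightarrow> 'v::ab_group_add \<Rightarrow> 'v) \<Rightarrow> (complex \<Rightarrow> 'w::ab_group_add \<Rightarrow> 'w) \<Rightarrow>
   ('v \<Rightarrow> 'w lfield) \<Rightarrow> bool" where
  "linear_to_LFie sV sW Y \<longleftrightarrow> (\<forall>a. Y a \<in> LFie sW) \<and>
     (\<forall>v \<gamma> k. Vector_Spaces.linear sV sW (\<lambda>a. Y a v \<gamma> k))"

definition equivariant ::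
  "(complex \<Rightarrow> 'w::ab_group_add \<Rightarrow> 'w) \<Rightarrow> ('v \<Rightarrow> 'v) \<Rightarrow> ('v \<Rightarrow> 'w lfield) \<Rightarrow> bool" where
  "equivariant sW \<phi> Y \<longleftrightarrow> (\<forall>a v. Y (\<phi> a) v = monodromy sW (Y a v))"

definition twisted_module ::
  "(complex \<Rightarrow> 'v::ab_group_add \<Rightarrow> 'v) \<Rightarrow> 'v \<Rightarrow> ('v \<Rightarrow> int \<Rightarrow> 'v \<Rightarrow> 'v) \<Rightarrow> ('v \<Rightarrow> 'v) \<Rightarrow>
   (complex \<Rightarrow> 'w::ab_group_add \<Rightarrow> 'w) \<Rightarrow> ('v \<Rightarrow> 'w lfield) \<Rightarrow> bool" where
  "twisted_module sV vac pr \<phi> sW Y \<longleftrightarrow>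
     vector_space sW \<and>
     linear_to_LFie sV sW Y \<and>
     Y vac = id_field \<and>
     local_collection sW (range Y) \<and>
     equivariant sW \<phi> Y \<and>
     (\<forall>a n b. Y (pr a n b) = lprod sW (Y a) n (Y b))"


section \<open>The Borcherds identity for twisted modules\<close>

text \<open>\<open>\<delta>\<^bsub>\<alpha>+\<N>\<^esub>(z\<^sub>1,z\<^sub>2)a\<close> as a series with coefficients in \<open>V\<close>: the exponents of
  \<open>z\<^sub>1\<close> and \<open>z\<^sub>2\<close> are \<open>-m-1\<close> and \<open>m\<close> with \<open>m \<in> \<alpha>\<close>, and \<open>\<zeta>\<^sub>1\<close>, \<open>\<zeta>\<^sub>2\<close> enter through
  the expansion of the exponential of \<open>(\<zeta>\<^sub>2 - \<zeta>\<^sub>1)\<N>\<close>.\<close>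

definition delta ::
  "(complex \<Rightarrow> 'v::ab_group_add \<Rightarrow> 'v) \<Rightarrow> complex set \<Rightarrow> ('v \<Rightarrow> 'v) \<Rightarrow> 'v \<Rightarrow> 'v ser2" where
  "delta s \<alpha> \<N> a = (\<lambda>\<gamma>1 k1 \<gamma>2 k2. if \<gamma>2 \<in> \<alpha> \<and> \<gamma>1 = - \<gamma>2 - 1
     then s ((-1) ^ k1 / (fact k1 * fact k2)) ((\<N> ^^ (k1 + k2)) a) else 0)"

text \<open>\<open>Y(A(z\<^sub>1,z\<^sub>2), z\<^sub>2)v\<close> for a \<open>V\<close>-valued series \<open>A\<close>: the linear extension of \<open>Y\<close>,
  multiplied out in the second pair of variables.\<close>

definition Y_ext :: "('v \<Rightarrow> 'w::ab_group_add lfield) \<Rightarrow> 'v ser2 \<Rightarrow> 'w \<Rightarrow> 'w ser2" where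
  "Y_ext Y A v = (\<lambda>\<gamma>1 k1 \<gamma>2 k2.
     Sum_any (\<lambda>\<gamma>. \<Sum>k\<le>k2. Y (A \<gamma>1 k1 \<gamma> k) v (\<gamma>2 - \<gamma>) (k2 - k)))"

text \<open>The sum over \<open>j\<close> is finite for given \<open>a\<close>, \<open>b\<close>, \<open>n\<close>, as \<open>\<N>\<close> is locally nilpotent.\<close>

definition twisted_borcherds ::
  "(complex \<Rightarrow> 'v::ab_group_add \<Rightarrow> 'v) \<Rightarrow> ('v \<Rightarrow> int \<Rightarrow> 'v \<Rightarrow> 'v) \<Rightarrow> ('v \<Rightarrow> 'v) \<Rightarrow> ('v \<Rightarrow> 'v) \<Rightarrow>
   (complex \<Rightarrow> 'w::ab_group_add \<Rightarrow> 'w) \<Rightarrow> ('v \<Rightarrow> 'w lfield) \<Rightarrow> bool" where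
  "twisted_borcherds sV pr \<sigma> \<N> sW Y \<longleftrightarrow>
     (\<forall>\<alpha>\<in>CmodZ. \<forall>a\<in>eigen_component sV \<sigma> \<alpha>. \<forall>b v n \<gamma>1 k1 \<gamma>2 k2.
        mult_iota12 sW n (comp12 (Y a) (Y b) v) \<gamma>1 k1 \<gamma>2 k2
        - mult_iota21 sW n (comp21 (Y b) (Y a) v) \<gamma>1 k1 \<gamma>2 k2
        = Sum_any (\<lambda>j::nat.
            Y_ext Y (\<lambda>\<gamma>1 k1 \<gamma>2 k2.
                pr (divided_power sV (D_z2 sV) j (delta sV \<alpha> \<N> a) \<gamma>1 k1 \<gamma>2 k2) (n + int j) b)
              v \<gamma>1 k1 \<gamma>2 k2))"

end

theory Submission
  imports Defs "HOL-Analysis.Complex_Transcendental"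
begin

text \<open>
  Equivariance controls the logarithms.  For \<open>a \<in> V\<^sub>\<alpha>\<close> let \<open>p\<^sub>a(\<zeta>)\<close> be the coefficient of
  \<open>z\<^sup>\<gamma>\<close> in \<open>Y(a,z)v\<close>, a polynomial in \<open>\<zeta>\<close>.  Equivariance equates
  \<open>e\<^bsup>2\<pi>i\<gamma>\<^esup> p\<^sub>a(\<zeta> + 2\<pi>i)\<close> with \<open>e\<^bsup>-2\<pi>i\<alpha>\<^esup> p\<^sub>c(\<zeta>)\<close>, where \<open>c = e\<^bsup>-2\<pi>i\<N>\<^esup>a\<close>.  Induction on
  the nilpotency order of \<open>\<N>\<close> on \<open>a\<close>, with a look at leading coefficients, shows that \<open>p\<^sub>a\<close>
  vanishes unless \<open>\<gamma> \<in> -\<alpha>\<close> (lemma \<open>Y_exponents\<close>), and that \<open>p\<^sub>a(\<zeta>)\<close> is the value at \<open>0\<close> of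
  \<open>p\<close> for the vector \<open>e\<^bsup>-\<zeta>\<N>\<^esup>a\<close> (lemma \<open>Y_log_coefficient\<close>).  So \<open>\<partial>\<^sub>\<zeta>\<close> acts on fields as
  \<open>-\<N>\<close> acts on vectors, and series are determined by their values at \<open>\<zeta>\<^sub>1 = \<zeta>\<^sub>2 = 0\<close>.

  Locality: fix \<open>b\<close> and choose \<open>M\<close> such that \<open>(\<N>\<^sup>ka)\<^sub>(\<^sub>n\<^sub>)b = 0\<close> for all \<open>k\<close> and all \<open>n \<ge> M\<close>.
  For \<open>n = M\<close> the right-hand side of the Borcherds identity is \<open>0\<close>, and both expansions
  of \<open>z\<^sub>1\<^sub>2\<^sup>M\<close> are the same polynomial.

  Products: let \<open>F\<^sub>a = z\<^sub>1\<^sub>2\<^sup>MY(a,z\<^sub>1)Y(b,z\<^sub>2)v\<close> and take \<open>n = M - 1 - j\<close>.  By locality the left-hand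
  side of the Borcherds identity is \<open>F\<^sub>a\<close> times the difference of the two expansions of
  \<open>z\<^sub>1\<^sub>2\<^bsup>-j-1\<^esup>\<close>, which is the sum over all integers \<open>p\<close> of \<open>(p choose j) z\<^sub>1\<^bsup>-p-1\<^esup>z\<^sub>2\<^bsup>p-j\<^esup>\<close>.  Pick any
  \<open>m \<in> \<alpha>\<close>; the coefficient of \<open>z\<^sub>1\<^bsup>-m-1\<^esup>\<close> at \<open>\<zeta>\<^sub>1 = \<zeta>\<^sub>2 = 0\<close> then contains the coefficients of
  \<open>F\<^sub>a\<close> at \<open>z\<^sub>1\<^sup>r\<close> with weights \<open>(m+r) choose j\<close>, and on the right-hand side the vector \<open>a\<close> is
  replaced by \<open>a\<^sub>i = ((m+\<N>) choose i) a\<close>.  The operator \<open>D\<close> in the first variables takes \<open>z\<^sub>1\<^sup>r\<close>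
  to \<open>(r-\<N>) z\<^sub>1\<^bsup>r-1\<^esup>\<close> since \<open>\<partial>\<^sub>\<zeta>\<close> is \<open>-\<N>\<close>, so its divided powers are the binomial coefficients of
  \<open>r - \<N>\<close>.  As \<open>(m+\<N>) + (r-\<N>) = m+r\<close>, Vandermonde's identity splits each weight into a sum
  over \<open>i \<le> j\<close>, and the left-hand side becomes the sum over \<open>i\<close> of the diagonal values of
  \<open>D\<^sup>(\<^sup>j\<^sup>-\<^sup>i\<^sup>)F\<close> for the vectors \<open>a\<^sub>i\<close>.  The right-hand side is the sum over \<open>i\<close> of the fields of
  \<open>(a\<^sub>i)\<^sub>(\<^sub>n\<^sub>+\<^sub>i\<^sub>)b\<close>.  By induction on \<open>j\<close> the summands with \<open>i \<ge> 1\<close> agree; hence so do those with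
  \<open>i = 0\<close>, which is the product formula at \<open>\<zeta> = 0\<close> (lemma \<open>diagonal_regular_deriv_zero_log\<close>).
  The coefficients of higher powers of \<open>\<zeta>\<close> follow because \<open>\<N>\<close> is a derivation.

  Finally a general \<open>a\<close> is a sum of eigenvectors of \<open>\<sigma>\<close>, and the \<open>n\<close>-th product may be
  computed with an order of locality common to all summands (lemma \<open>lprod_from_order\<close>).
\<close>


section \<open>Finitely supported sums\<close>

lemma Sum_any_reindex:
  assumes "inj h" and "\<And>x. f x \<noteq> 0 \<Longrightarrow> x \<in> range h"
  shows "Sum_any f = Sum_any (\<lambda>i. f (h i))"
proof -
  have "{x. f x \<noteq> 0} = h ` {i. f (h i) \<noteq> 0}"
    using assms(2) by auto
  then show ?thesis
    unfolding Sum_any.expand_set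
    using sum.reindex[of h "{i. f (h i) \<noteq> 0}" f] assms(1)
    by (simp add: inj_on_subset)
qed

lemma Sum_any_additive:
  fixes L :: "'a::comm_monoid_add \<Rightarrow> 'b::comm_monoid_add"
  assumes "L 0 = 0" and "\<And>x y. L (x + y) = L x + L y" and "finite {i. f i \<noteq> 0}"
  shows "L (Sum_any f) = Sum_any (\<lambda>i. L (f i))"
proof -
  have L_sum: "L (sum f S) = (\<Sum>i\<in>S. L (f i))" if "finite S" for S
    using that by (induction S) (simp_all add: assms)
  have "{i. L (f i) \<noteq> 0} \<subseteq> {i. f i \<noteq> 0}"
    using assms(1) by auto
  then show ?thesis
    using Sum_any.expand_superset[OF assms(3), of "\<lambda>i. L (f i)"] L_sum[OF assms(3)]
    by (simp add: Sum_any.expand_set[of f])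
qed

lemma Sum_any_sum:
  assumes "finite K" and "\<And>k. k \<in> K \<Longrightarrow> finite {i. f i k \<noteq> 0}"
  shows "Sum_any (\<lambda>i. \<Sum>k\<in>K. f i k) = (\<Sum>k\<in>K. Sum_any (\<lambda>i. f i k))"
proof -
  let ?S = "\<Union>k\<in>K. {i. f i k \<noteq> 0}"
  have fin: "finite ?S" using assms by blast
  have "Sum_any (\<lambda>i. \<Sum>k\<in>K. f i k) = (\<Sum>i\<in>?S. \<Sum>k\<in>K. f i k)"
    by (rule Sum_any.expand_superset[OF fin]) (auto intro: sum.neutral)
  also have "\<dots> = (\<Sum>k\<in>K. \<Sum>i\<in>?S. f i k)"
    by (rule sum.swap)
  also have "\<dots> = (\<Sum>k\<in>K. Sum_any (\<lambda>i. f i k))"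
    by (rule sum.cong[OF refl], rule Sum_any.expand_superset[OF fin, symmetric]) auto
  finally show ?thesis .
qed

lemma Sum_any_lessThan:
  fixes f :: "nat \<Rightarrow> 'a::comm_monoid_add"
  assumes "\<And>k. k \<ge> l \<Longrightarrow> f k = 0"
  shows "Sum_any f = (\<Sum>k<l. f k)"
  using assms by (intro Sum_any.expand_superset) (auto simp flip: not_le)

lemma linear_props:
  assumes "Vector_Spaces.linear s1 s2 f"
  shows "f (x + y) = f x + f y" "f (s1 c x) = s2 c (f x)" "f 0 = 0"
    "f (x - y) = f x - f y" "f (- x) = - f x" "f (sum g A) = (\<Sum>i\<in>A. f (g i))"
proof -
  interpret module_hom s1 s2 f
    using assms by (simp add: module_hom_iff_linear)
  show "f (x + y) = f x + f y" "f (s1 c x) = s2 c (f x)" "f 0 = 0"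
    "f (x - y) = f x - f y" "f (- x) = - f x" "f (sum g A) = (\<Sum>i\<in>A. f (g i))"
    by (simp_all add: add scale zero diff neg sum)
qed

lemma finite_nonzero_has_last:
  fixes f :: "nat \<Rightarrow> 'x::zero"
  assumes "finite {i. f i \<noteq> 0}" and "f k \<noteq> 0"
  obtains d where "f d \<noteq> 0" "\<And>i. i > d \<Longrightarrow> f i = 0"
proof
  let ?d = "Max {i. f i \<noteq> 0}"
  have "?d \<in> {i. f i \<noteq> 0}"
    by (rule Max_in) (use assms in auto)
  then show "f ?d \<noteq> 0" by simp
  show "f i = 0" if "i > ?d" for i
    using Max_ge[OF assms(1), of i] that by (cases "f i = 0") auto
qed


section \<open>Binomial coefficients of operators\<close>

text \<open>The operator \<open>X(X-1)\<cdots>(X-i+1)/i!\<close>.\<close>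

primrec op_choose ::
  "(complex \<Rightarrow> 'v::ab_group_add \<Rightarrow> 'v) \<Rightarrow> ('v \<Rightarrow> 'v) \<Rightarrow> nat \<Rightarrow> 'v \<Rightarrow> 'v" where
  "op_choose s X 0 a = a"
| "op_choose s X (Suc i) a =
     s (1 / of_nat (Suc i)) (X (op_choose s X i a) - s (of_nat i) (op_choose s X i a))"

lemma gbinomial_Suc_step:
  "of_nat (Suc j) * (c gchoose Suc j) = (c - of_nat j) * (c gchoose j)" for c :: complex
  using gbinomial_absorption[of j c] gbinomial_absorb_comp[of c j] by simp

locale complex_vector_space = vector_space scale
  for scale :: "complex \<Rightarrow> 'b::ab_group_add \<Rightarrow> 'b"
begin

lemma op_choose_in_subspace:
  assumes "subspace U" and "\<And>x. x \<in> U \<Longrightarrow> X x \<in> U" and "a \<in> U"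
  shows "op_choose scale X i a \<in> U"
  using assms by (induction i) (auto intro!: subspace_scale subspace_diff)

lemma op_choose_linear:
  assumes "Vector_Spaces.linear scale scale X"
  shows "Vector_Spaces.linear scale scale (op_choose scale X i)"
proof (induction i)
  case 0
  show ?case by (simp add: Vector_Spaces.linear_iff vector_space_axioms)
next
  case (Suc i)
  show ?case
    unfolding Vector_Spaces.linear_iff
    by (auto simp: vector_space_axioms linear_props[OF Suc] linear_props[OF assms]
        scale_right_distrib scale_right_diff_distrib mult.commute)
qed

lemma op_choose_commute:
  assumes "Vector_Spaces.linear scale scale T" and "\<And>x. T (X x) = X (T x)"
  shows "T (op_choose scale X i a) = op_choose scale X i (T a)"
  by (induction i) (simp_all add: linear_props[OF assms(1)] assms(2))

lemma Suc_scale_op_choose: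
  "scale (of_nat (Suc i)) (op_choose scale X (Suc i) a)
     = X (op_choose scale X i a) - scale (of_nat i) (op_choose scale X i a)"
  by (simp del: of_nat_Suc)

text \<open>As \<open>X + Z = c\<close> is a scalar, \<open>X\<close> and \<open>Z\<close> commute, and the usual proof of
  Vandermonde's identity applies to operators.\<close>

lemma op_choose_Vandermonde:
  assumes X: "Vector_Spaces.linear scale scale X" and Z: "Vector_Spaces.linear scale scale Z"
    and XZ: "\<And>x. X x + Z x = scale c x"
  shows "(\<Sum>i\<le>j. op_choose scale X i (op_choose scale Z (j - i) a)) = scale (c gchoose j) a"
proof (induction j)
  case 0
  show ?case by simp
next
  case (Suc j)
  let ?X = "op_choose scale X" and ?Z = "op_choose scale Z"
  have Z_eq: "Z x = scale c x - X x" for x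
    using XZ[of x] by (simp add: algebra_simps)
  have comm: "Z (?X i x) = ?X i (Z x)" for i x
    by (rule op_choose_commute[OF Z]) (simp add: Z_eq linear_props[OF X])
  let ?T = "\<lambda>i. ?X i (?Z (Suc j - i) a)"
  let ?t = "\<lambda>i. ?X i (?Z (j - i) a)"
  \<comment> \<open>Multiplying by \<open>j+1 = i + (j+1-i)\<close> allows lowering one of the two factors of each term,
    at the price of \<open>X - i\<close> or \<open>Z - (j-i)\<close>; these add up to the scalar \<open>c - j\<close>.\<close>
  have "scale (of_nat (Suc j)) (\<Sum>i\<le>Suc j. ?T i)
      = (\<Sum>i\<le>Suc j. scale (of_nat i) (?T i) + scale (of_nat (Suc j - i)) (?T i))"
    unfolding scale_sum_right
    by (rule sum.cong) (simp_all add: scale_left_distrib[symmetric] flip: of_nat_add)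
  also have "\<dots> = (\<Sum>i\<le>Suc j. scale (of_nat i) (?T i))
      + (\<Sum>i\<le>Suc j. scale (of_nat (Suc j - i)) (?T i))"
    by (rule sum.distrib)
  also have "(\<Sum>i\<le>Suc j. scale (of_nat i) (?T i)) = (\<Sum>i\<le>j. X (?t i) - scale (of_nat i) (?t i))"
    by (subst sum.atMost_Suc_shift) (simp only: Suc_scale_op_choose diff_Suc_Suc; simp)
  also have "(\<Sum>i\<le>Suc j. scale (of_nat (Suc j - i)) (?T i))
      = (\<Sum>i\<le>j. scale (of_nat (Suc j - i)) (?T i))"
    by simp
  also have "\<dots> = (\<Sum>i\<le>j. Z (?t i) - scale (of_nat (j - i)) (?t i))"
  proof (rule sum.cong[OF refl])
    fix i assume "i \<in> {..j}"
    then have i: "Suc j - i = Suc (j - i)" by auto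
    show "scale (of_nat (Suc j - i)) (?T i) = Z (?t i) - scale (of_nat (j - i)) (?t i)"
      unfolding i
      using Suc_scale_op_choose[of "j - i" Z a]
      by (simp add: linear_props[OF op_choose_linear[OF X]] comm del: op_choose.simps
          flip: linear_props(2)[OF op_choose_linear[OF X]])
  qed
  also have "(\<Sum>i\<le>j. X (?t i) - scale (of_nat i) (?t i))
        + (\<Sum>i\<le>j. Z (?t i) - scale (of_nat (j - i)) (?t i))
      = (\<Sum>i\<le>j. scale (c - of_nat j) (?t i))"
    unfolding sum.distrib[symmetric]
  proof (rule sum.cong[OF refl])
    fix i assume "i \<in> {..j}"
    then have "(of_nat j :: complex) = of_nat i + of_nat (j - i)"
      by (simp flip: of_nat_add)
    then show "X (?t i) - scale (of_nat i) (?t i) + (Z (?t i) - scale (of_nat (j - i)) (?t i))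
        = scale (c - of_nat j) (?t i)"
      by (simp add: Z_eq algebra_simps scale_left_distrib)
  qed
  also have "\<dots> = scale (c - of_nat j) (scale (c gchoose j) a)"
    by (simp add: Suc.IH flip: scale_sum_right)
  also have "\<dots> = scale (of_nat (Suc j)) (scale (c gchoose Suc j) a)"
    by (simp only: scale_scale gbinomial_Suc_step)
  finally show ?case
    by (simp del: of_nat_Suc sum.atMost_Suc scale_scale)
qed

end


section \<open>The derivation D on logarithmic series\<close>

text \<open>The derivation \<open>D = \<partial>\<^sub>z + z\<^sup>-\<^sup>1\<partial>\<^sub>\<zeta>\<close> in a single pair of variables; it serves both \<^const>\<open>D_z1\<close>
  and \<^const>\<open>D_z2\<close>.\<close>

definition D_log :: "(complex \<Rightarrow> 'w::plus \<Rightarrow> 'w) \<Rightarrow> 'w ser \<Rightarrow> 'w ser" where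
  "D_log s f = (\<lambda>\<gamma> k. s (\<gamma> + 1) (f (\<gamma> + 1) k) + s (of_nat (Suc k)) (f (\<gamma> + 1) (Suc k)))"

lemma D_z1_funpow: "(D_z1 s ^^ i) F \<gamma>1 k1 \<gamma>2 k2 = (D_log s ^^ i) (\<lambda>\<gamma> k. F \<gamma> k \<gamma>2 k2) \<gamma>1 k1"
proof -
  have "(\<lambda>\<gamma> k. (D_z1 s ^^ i) F \<gamma> k \<gamma>2 k2) = (D_log s ^^ i) (\<lambda>\<gamma> k. F \<gamma> k \<gamma>2 k2)"
    by (induction i) (auto simp: D_z1_def D_log_def fun_eq_iff)
  then show ?thesis by metis
qed

lemma D_z2_funpow: "(D_z2 s ^^ i) F \<gamma>1 k1 \<gamma>2 k2 = (D_log s ^^ i) (F \<gamma>1 k1) \<gamma>2 k2"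
proof -
  have "(D_z2 s ^^ i) F \<gamma>1 k1 = (D_log s ^^ i) (F \<gamma>1 k1)"
    by (induction i) (auto simp: D_z2_def D_log_def fun_eq_iff)
  then show ?thesis by simp
qed

text \<open>If \<open>\<partial>\<^sub>\<zeta>\<close> acts on a family of series \<open>H a\<close> through an operator \<open>X\<close> on the parameter,
  then \<open>D\<close> takes the coefficient at \<open>z\<^sup>r\<close> to the exponent \<open>r - 1\<close> and applies \<open>r + X\<close> to the
  parameter.  After \<open>i\<close> steps the factors are \<open>r + X, \<dots>, r + X - i + 1\<close> with \<open>r = \<gamma> + i\<close>.\<close>

lemma (in complex_vector_space) D_log_funpow_family:
  assumes H: "\<And>\<gamma> k. Vector_Spaces.linear scale s' (\<lambda>a. H a \<gamma> k)"
    and law: "\<And>a \<gamma> k. s' (of_nat (Suc k)) (H a \<gamma> (Suc k)) = H (X a) \<gamma> k"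
  shows "s' (1 / fact i) ((D_log s' ^^ i) (H a) \<gamma> k)
    = H (op_choose scale (\<lambda>a. scale (\<gamma> + of_nat i) a + X a) i a) (\<gamma> + of_nat i) k"
proof (induction i arbitrary: \<gamma> k)
  case 0
  interpret s': vector_space s'
    using H[of 0 0] by (simp add: Vector_Spaces.linear_iff)
  show ?case by simp
next
  case (Suc i)
  interpret s': vector_space s'
    using H[of 0 0] by (simp add: Vector_Spaces.linear_iff)
  let ?f = "(D_log s' ^^ i) (H a)"
  let ?x = "\<gamma> + of_nat (Suc i)"
  define b where "b = op_choose scale (\<lambda>a. scale ?x a + X a) i a"
  have x: "(\<gamma> + 1) + of_nat i = ?x" by simp
  have IH: "s' (1 / fact i) (?f (\<gamma> + 1) k') = H b ?x k'" for k'
    using Suc[of "\<gamma> + 1" k'] unfolding x b_def .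
  have fct: "1 / fact (Suc i) = (1 / of_nat (Suc i)) * (1 / fact i :: complex)"
    by simp
  have "s' (1 / fact (Suc i)) ((D_log s' ^^ Suc i) (H a) \<gamma> k)
      = s' (1 / of_nat (Suc i)) (s' (1 / fact i)
          (s' (\<gamma> + 1) (?f (\<gamma> + 1) k) + s' (of_nat (Suc k)) (?f (\<gamma> + 1) (Suc k))))"
    unfolding fct s'.scale_scale[symmetric] by (simp add: D_log_def)
  also have "\<dots> = s' (1 / of_nat (Suc i)) (s' (\<gamma> + 1) (s' (1 / fact i) (?f (\<gamma> + 1) k))
      + s' (of_nat (Suc k)) (s' (1 / fact i) (?f (\<gamma> + 1) (Suc k))))"
    by (simp only: s'.scale_right_distrib s'.scale_scale mult.commute)
  also have "\<dots> = s' (1 / of_nat (Suc i)) (s' (\<gamma> + 1) (H b ?x k) + H (X b) ?x k)"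
    unfolding IH law ..
  also have "\<dots> = H (scale (1 / of_nat (Suc i)) (scale (\<gamma> + 1) b + X b)) ?x k"
    by (simp only: linear_props[OF H])
  also have "scale (\<gamma> + 1) b + X b = (scale ?x b + X b) - scale (of_nat i) b"
    by (simp add: scale_left_distrib algebra_simps)
  finally show ?case
    by (simp add: b_def del: of_nat_Suc)
qed


section \<open>Expansions of powers of \<open>z\<^sub>1 - z\<^sub>2\<close>\<close>

definition swap_series :: "'w ser2 \<Rightarrow> 'w ser2" where
  "swap_series F = (\<lambda>\<gamma>1 k1 \<gamma>2 k2. F \<gamma>2 k2 \<gamma>1 k1)"

text \<open>The condition under which the expansion of \<open>z\<^sub>1\<^sub>2\<^sup>n\<close> in nonnegative powers of \<open>z\<^sub>2\<close> can be
  multiplied with \<open>F\<close>.\<close>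

definition lower_bounded2 :: "'w::zero ser2 \<Rightarrow> bool" where
  "lower_bounded2 F \<longleftrightarrow> (\<forall>\<gamma>1 k1 \<gamma>2 k2.
     finite {i::nat. F (\<gamma>1 + of_nat i) k1 (\<gamma>2 - of_nat i) k2 \<noteq> 0})"

definition lower_bounded1 :: "'w::zero ser2 \<Rightarrow> bool" where
  "lower_bounded1 F \<longleftrightarrow> lower_bounded2 (swap_series F)"

lemma finite_diff_support:
  fixes f g :: "'i \<Rightarrow> 'w::group_add"
  assumes "finite {i. f i \<noteq> 0}" and "finite {i. g i \<noteq> 0}"
  shows "finite {i. f i - g i \<noteq> 0}"
  by (rule finite_subset[of _ "{i. f i \<noteq> 0} \<union> {i. g i \<noteq> 0}"]) (use assms in auto)

lemma lower_bounded2_mult_z12: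
  fixes F :: "'w::ab_group_add ser2"
  assumes "lower_bounded2 F"
  shows "lower_bounded2 (mult_z12 F)"
proof -
  have fin: "finite {i::nat. F (\<gamma>1 + of_nat i) k1 (\<gamma>2 - of_nat i) k2 \<noteq> 0}" for \<gamma>1 k1 \<gamma>2 k2
    using assms by (simp add: lower_bounded2_def)
  show ?thesis
    unfolding lower_bounded2_def mult_z12_def
    using finite_diff_support[OF fin[of "_ - 1"] fin[of _ _ "_ - 1"]]
    by (simp add: algebra_simps)
qed

context complex_vector_space
begin

text \<open>One factor \<open>z\<^sub>1\<^sub>2\<close> can be moved from the expanded power into the series.  This is Pascal's
  rule; the finiteness condition makes it legitimate to split the sum.\<close>

lemma mult_iota12_mult_z12:
  assumes "lower_bounded2 G"
  shows "mult_iota12 scale n G = mult_iota12 scale (n - 1) (mult_z12 G)"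
proof (intro ext)
  fix \<gamma>1 k1 \<gamma>2 k2
  define g where "g i = G (\<gamma>1 - of_int n + of_nat i) k1 (\<gamma>2 - of_nat i) k2" for i :: nat
  define c :: "int \<Rightarrow> nat \<Rightarrow> complex" where "c m i = (of_int m gchoose i) * (-1) ^ i" for m i
  have fin: "finite {i. g i \<noteq> 0}"
    using assms unfolding lower_bounded2_def g_def by blast
  then have fin_shift: "finite {i. g (Suc i) \<noteq> 0}"
    using finite_vimageI[OF fin, of Suc] by (simp add: vimage_def)
  have fin_c: "finite {i. scale (c m i) (h i) \<noteq> 0}" if "finite {i. h i \<noteq> 0}" for m h
    by (rule finite_subset[OF _ that]) auto
  \<comment> \<open>Pascal's rule for the coefficients of the expansion.\<close>
  have pascal: "c n 0 = c (n - 1) 0" "c n (Suc i) = c (n - 1) (Suc i) - c (n - 1) i" for i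
    using gbinomial_Suc_Suc[of "of_int n - 1 :: complex" i]
    by (simp_all add: c_def algebra_simps)
  have lhs: "mult_iota12 scale n G \<gamma>1 k1 \<gamma>2 k2 = Sum_any (\<lambda>i. scale (c n i) (g i))"
    unfolding mult_iota12_def g_def c_def
    by (simp add: algebra_simps)
  have step: "mult_z12 G (\<gamma>1 - (of_int (n - 1) - of_nat i)) k1 (\<gamma>2 - of_nat i) k2
      = g i - g (Suc i)" for i
    unfolding mult_z12_def g_def by (simp add: algebra_simps)
  have "mult_iota12 scale (n - 1) (mult_z12 G) \<gamma>1 k1 \<gamma>2 k2
      = Sum_any (\<lambda>i. scale (c (n - 1) i) (g i) + scale (- c (n - 1) i) (g (Suc i)))"
    unfolding mult_iota12_def step c_def[symmetric]
    by (simp add: scale_right_diff_distrib)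
  also have "\<dots> = Sum_any (\<lambda>i. scale (c (n - 1) i) (g i))
      + Sum_any (\<lambda>i. scale (- c (n - 1) i) (g (Suc i)))"
    by (rule Sum_any.distrib) (use fin_c[OF fin] fin_c[OF fin_shift] in auto)
  also have "Sum_any (\<lambda>i. scale (- c (n - 1) i) (g (Suc i)))
      = Sum_any (\<lambda>i. scale (if i = 0 then 0 else - c (n - 1) (i - 1)) (g i))"
    by (subst Sum_any_reindex[of Suc "\<lambda>i. scale (if i = 0 then 0 else - c (n - 1) (i - 1)) (g i)"])
      (auto simp: image_iff split: if_splits dest: gr0_implies_Suc)
  also have "Sum_any (\<lambda>i. scale (c (n - 1) i) (g i))
        + Sum_any (\<lambda>i. scale (if i = 0 then 0 else - c (n - 1) (i - 1)) (g i))
      = Sum_any (\<lambda>i. scale (c (n - 1) i) (g i)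
          + scale (if i = 0 then 0 else - c (n - 1) (i - 1)) (g i))"
    by (rule Sum_any.distrib[symmetric]; rule finite_subset[OF _ fin]; auto)
  also have "\<dots> = Sum_any (\<lambda>i. scale (c n i) (g i))"
  proof (rule Sum_any.cong)
    fix i
    show "scale (c (n - 1) i) (g i) + scale (if i = 0 then 0 else - c (n - 1) (i - 1)) (g i)
        = scale (c n i) (g i)"
      by (cases i) (simp_all add: pascal scale_left_diff_distrib)
  qed
  finally show "mult_iota12 scale n G \<gamma>1 k1 \<gamma>2 k2
      = mult_iota12 scale (n - 1) (mult_z12 G) \<gamma>1 k1 \<gamma>2 k2"
    using lhs by simp
qed

lemma mult_iota12_funpow_mult_z12:
  assumes "lower_bounded2 G"
  shows "mult_iota12 scale n G = mult_iota12 scale (n - int M) ((mult_z12 ^^ M) G)"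
  using assms
proof (induction M arbitrary: n G)
  case (Suc M)
  show ?case
    using mult_iota12_mult_z12[OF Suc.prems, of n]
      Suc.IH[OF lower_bounded2_mult_z12[OF Suc.prems], of "n - 1"]
    by (simp add: algebra_simps funpow_swap1)
qed simp

text \<open>The two expansions are exchanged by swapping the variables, up to the sign of \<open>(-1)\<^sup>n\<close>, so
  facts about the second one follow from the first.\<close>

lemma mult_iota21_swap:
  "mult_iota21 scale n G \<gamma>1 k1 \<gamma>2 k2
     = scale ((-1) powi n) (mult_iota12 scale n (swap_series G) \<gamma>2 k2 \<gamma>1 k1)"
proof -
  define f where "f = (\<lambda>i. scale ((of_int n gchoose i) * (-1) ^ i)
      (G (\<gamma>1 - of_nat i) k1 (\<gamma>2 - (of_int n - of_nat i)) k2))"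
  have "scale ((-1) powi n) (Sum_any f) = Sum_any (\<lambda>i. scale ((-1) powi n) (f i))"
  proof (cases "finite {i. f i \<noteq> 0}")
    case True
    then show ?thesis
      by (intro Sum_any_additive) (simp_all add: scale_right_distrib)
  next
    case False
    then show ?thesis
      by (simp add: Sum_any.infinite)
  qed
  then show ?thesis
    by (simp add: mult_iota21_def mult_iota12_def swap_series_def f_def power_int_add mult_ac)
qed

lemma funpow_mult_z12_swap:
  "(mult_z12 ^^ M) (swap_series G)
     = (\<lambda>\<gamma>1 k1 \<gamma>2 k2. scale ((-1) ^ M) (swap_series ((mult_z12 ^^ M) G) \<gamma>1 k1 \<gamma>2 k2))"
proof (induction M)
  case (Suc M)
  show ?case
    unfolding funpow.simps comp_def Suc.IH
    by (intro ext) (simp add: mult_z12_def swap_series_def scale_right_diff_distrib)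
qed simp

lemma mult_iota12_scale:
  "mult_iota12 scale n (\<lambda>\<gamma>1 k1 \<gamma>2 k2. scale c (G \<gamma>1 k1 \<gamma>2 k2)) \<gamma>1 k1 \<gamma>2 k2
     = scale c (mult_iota12 scale n G \<gamma>1 k1 \<gamma>2 k2)"
proof -
  define f where "f = (\<lambda>i. scale ((of_int n gchoose i) * (-1) ^ i)
       (G (\<gamma>1 - (of_int n - of_nat i)) k1 (\<gamma>2 - of_nat i) k2))"
  have "scale c (Sum_any f) = Sum_any (\<lambda>i. scale c (f i))"
  proof (cases "c = 0 \<or> finite {i. f i \<noteq> 0}")
    case True
    then show ?thesis
      by (auto intro: Sum_any_additive simp: scale_right_distrib)
  next
    case False
    then show ?thesis
      by (simp add: Sum_any.infinite)
  qed
  then show ?thesis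
    by (simp add: mult_iota12_def f_def mult_ac)
qed

lemma mult_iota21_funpow_mult_z12:
  assumes "lower_bounded1 G"
  shows "mult_iota21 scale n G = mult_iota21 scale (n - int M) ((mult_z12 ^^ M) G)"
proof (intro ext)
  fix \<gamma>1 k1 \<gamma>2 k2
  have powi: "(-1) powi n * (-1) ^ M = ((-1) powi (n - int M) :: complex)"
    by (simp add: power_int_diff) (simp add: field_simps flip: power_mult_distrib)
  have "mult_iota21 scale n G \<gamma>1 k1 \<gamma>2 k2
      = scale ((-1) powi n) (scale ((-1) ^ M)
          (mult_iota12 scale (n - int M) (swap_series ((mult_z12 ^^ M) G)) \<gamma>2 k2 \<gamma>1 k1))"
    unfolding mult_iota21_swap
      mult_iota12_funpow_mult_z12[OF assms[unfolded lower_bounded1_def], of n M]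
      funpow_mult_z12_swap mult_iota12_scale ..
  then show "mult_iota21 scale n G \<gamma>1 k1 \<gamma>2 k2
      = mult_iota21 scale (n - int M) ((mult_z12 ^^ M) G) \<gamma>1 k1 \<gamma>2 k2"
    by (simp add: mult_iota21_swap powi)
qed

lemma mult_iota_zero [simp]: "mult_iota12 scale 0 G = G" "mult_iota21 scale 0 G = G"
proof -
  have iota12: "mult_iota12 scale 0 H = H" for H
  proof (intro ext)
    fix \<gamma>1 k1 \<gamma>2 k2
    have "mult_iota12 scale 0 H \<gamma>1 k1 \<gamma>2 k2 = Sum_any (\<lambda>i::nat. if i = 0 then H \<gamma>1 k1 \<gamma>2 k2 else 0)"
      unfolding mult_iota12_def
      by (rule Sum_any.cong) (simp add: gbinomial_0_left)
    then show "mult_iota12 scale 0 H \<gamma>1 k1 \<gamma>2 k2 = H \<gamma>1 k1 \<gamma>2 k2"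
      by (simp only: Sum_any.delta)
  qed
  then show "mult_iota12 scale 0 G = G" .
  show "mult_iota21 scale 0 G = G"
    by (intro ext) (simp add: mult_iota21_swap iota12, simp add: swap_series_def)
qed

text \<open>This is \<open>D\<^sub>2\<^sup>(\<^sup>j\<^sup>)\<delta>(z\<^sub>1,z\<^sub>2)\<close> times \<open>F\<close>: the expansion for large \<open>z\<^sub>1\<close> contributes the
  terms with \<open>p \<ge> j\<close>, the other one those with \<open>p < 0\<close>, and the binomial coefficient vanishes
  in between.\<close>

lemma iota_difference:
  assumes fin: "finite {p::int. F (\<gamma>1 + 1 + of_int p) k1 (\<gamma>2 + of_nat j - of_int p) k2 \<noteq> 0}"
  shows "mult_iota12 scale (- int j - 1) F \<gamma>1 k1 \<gamma>2 k2 - mult_iota21 scale (- int j - 1) F \<gamma>1 k1 \<gamma>2 k2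
    = Sum_any (\<lambda>p::int. scale (of_int p gchoose j)
        (F (\<gamma>1 + 1 + of_int p) k1 (\<gamma>2 + of_nat j - of_int p) k2))"
proof -
  define g where "g p = F (\<gamma>1 + 1 + of_int p) k1 (\<gamma>2 + of_nat j - of_int p) k2" for p :: int
  define f where "f p = scale (of_int p gchoose j) (g p)" for p :: int
  have fin_f: "finite {p. f p \<noteq> 0}"
    by (rule finite_subset[OF _ fin]) (auto simp: f_def g_def)
  have choose_sym: "(of_nat (i + j) gchoose i :: complex) = of_nat (i + j) gchoose j" for i
    using gbinomial_of_nat_symmetric[of i "i + j", where 'a = complex] by simp
  have f_zero: "f p = 0" if "0 \<le> p" "p < int j" for p
  proof -
    have "(of_int p gchoose j :: complex) = of_nat (nat p choose j)"
      using that by (simp add: binomial_gbinomial)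
    then show ?thesis using that by (simp add: f_def binomial_eq_0)
  qed
  have coeff: "(of_int (- int j - 1) gchoose i :: complex) = (-1) ^ i * (of_nat (i + j) gchoose j)" for i
  proof -
    have "of_int (- int j - 1) = (- (of_nat j + 1) :: complex)"
      by simp
    then show ?thesis
      using choose_sym[of i] by (simp only: gbinomial_minus) (simp add: add_ac)
  qed
  have coeff_neg: "(of_int (- 1 - int i) gchoose j :: complex) = (-1) ^ j * (of_nat (i + j) gchoose j)" for i
    using gbinomial_minus[of "of_nat i + 1 :: complex" j]
    by (simp add: algebra_simps)
  have sign: "(-1) ^ i * ((-1) powi (- int j - 1 + int i)) = - ((-1) ^ j :: complex)" for i
  proof -
    have "(-1) powi (- int j - 1 + int i) = ((-1) ^ i / (-1) ^ (j + 1) :: complex)"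
      by (simp add: power_int_add power_int_minus power_int_diff field_simps)
    then show ?thesis
      by (simp add: minus_one_power_iff)
  qed
  \<comment> \<open>Substitute \<open>p = i + j\<close> for \<open>p \<ge> 0\<close> and \<open>p = -1 - i\<close> for \<open>p < 0\<close>.\<close>
  have "Sum_any f = Sum_any (\<lambda>p. (if 0 \<le> p then f p else 0) + (if p < 0 then f p else 0))"
    by (rule Sum_any.cong) auto
  also have "\<dots> = Sum_any (\<lambda>p. if 0 \<le> p then f p else 0) + Sum_any (\<lambda>p. if p < 0 then f p else 0)"
    by (rule Sum_any.distrib; rule finite_subset[OF _ fin_f]; auto)
  also have "Sum_any (\<lambda>p. if 0 \<le> p then f p else 0) = Sum_any (\<lambda>i::nat. f (int (i + j)))"
  proof (subst Sum_any_reindex[of "\<lambda>i. int (i + j)"])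
    show "inj (\<lambda>i. int (i + j))" by (auto intro: injI)
    fix p assume "(if 0 \<le> p then f p else 0) \<noteq> 0"
    then have "p = int (nat (p - int j) + j)"
      using f_zero[of p] by (cases "p < int j") (auto split: if_splits)
    then show "p \<in> range (\<lambda>i. int (i + j))" by blast
  qed simp
  also have "Sum_any (\<lambda>p. if p < 0 then f p else 0) = Sum_any (\<lambda>i::nat. f (- 1 - int i))"
  proof (subst Sum_any_reindex[of "\<lambda>i. - 1 - int i"])
    show "inj (\<lambda>i. - 1 - int i)" by (auto intro: injI)
    fix p assume "(if p < 0 then f p else 0) \<noteq> 0"
    then have "p = - 1 - int (nat (- 1 - p))"
      by (auto split: if_splits)
    then show "p \<in> range (\<lambda>i. - 1 - int i)" by blast
  qed simp
  also have "Sum_any (\<lambda>i::nat. f (int (i + j))) = mult_iota12 scale (- int j - 1) F \<gamma>1 k1 \<gamma>2 k2"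
    unfolding mult_iota12_def coeff
    by (rule Sum_any.cong)
      (simp add: f_def g_def algebra_simps flip: power_mult_distrib)
  also have "Sum_any (\<lambda>i::nat. f (- 1 - int i)) = Sum_any (\<lambda>i. - scale ((of_int (- int j - 1) gchoose i)
       * (-1) powi (- int j - 1 + int i))
        (F (\<gamma>1 - of_nat i) k1 (\<gamma>2 - (of_int (- int j - 1) - of_nat i)) k2))"
  proof (rule Sum_any.cong)
    fix i
    have "(of_int (- int j - 1) gchoose i) * (-1) powi (- int j - 1 + int i)
        = (-1) ^ i * (-1) powi (- int j - 1 + int i) * (of_nat (i + j) gchoose j :: complex)"
      unfolding coeff by (simp only: mult_ac)
    also have "\<dots> = - (of_int (- 1 - int i) gchoose j)"
      unfolding coeff_neg sign by simp
    finally have "(of_int (- int j - 1) gchoose i) * (-1) powi (- int j - 1 + int i)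
        = - (of_int (- 1 - int i) gchoose j :: complex)" .
    then show "f (- 1 - int i) = - scale ((of_int (- int j - 1) gchoose i)
       * (-1) powi (- int j - 1 + int i))
        (F (\<gamma>1 - of_nat i) k1 (\<gamma>2 - (of_int (- int j - 1) - of_nat i)) k2)"
      by (simp add: f_def g_def algebra_simps)
  qed
  also have "\<dots> = - mult_iota21 scale (- int j - 1) F \<gamma>1 k1 \<gamma>2 k2"
    unfolding mult_iota21_def Sum_any.expand_set by (simp add: sum_negf)
  finally show ?thesis
    by (simp add: f_def g_def)
qed

end


section \<open>Restriction to the diagonal\<close>

text \<open>The condition under which setting \<open>z\<^sub>1 = z\<^sub>2\<close> produces finite sums.\<close>

definition antidiag_finite :: "'w::zero ser2 \<Rightarrow> bool" where
  "antidiag_finite F \<longleftrightarrow> (\<forall>\<gamma>. finite {\<gamma>1. \<exists>k1 k2. F \<gamma>1 k1 (\<gamma> - \<gamma>1) k2 \<noteq> 0})"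

lemma antidiag_finiteD: "antidiag_finite F \<Longrightarrow> finite {\<gamma>1. \<exists>k1 k2. F \<gamma>1 k1 (\<gamma> - \<gamma>1) k2 \<noteq> 0}"
  by (simp add: antidiag_finite_def)

lemma antidiag_finite_term:
  "antidiag_finite F \<Longrightarrow> finite {\<gamma>1. F \<gamma>1 k1 (\<gamma> - \<gamma>1) k2 \<noteq> 0}"
  by (rule finite_subset[OF _ antidiag_finiteD[of F \<gamma>]]) auto

lemma antidiag_finite_diagonal:
  assumes "antidiag_finite F"
  shows "finite {\<gamma>1. (\<Sum>k1\<le>k. F \<gamma>1 k1 (\<gamma> - \<gamma>1) (k - k1)) \<noteq> 0}"
proof (rule finite_subset[OF _ antidiag_finiteD[OF assms, of \<gamma>]], rule subsetI)
  fix x assume "x \<in> {\<gamma>1. (\<Sum>k1\<le>k. F \<gamma>1 k1 (\<gamma> - \<gamma>1) (k - k1)) \<noteq> 0}"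
  then obtain k1 where "F x k1 (\<gamma> - x) (k - k1) \<noteq> 0"
    by (auto elim: sum.not_neutral_contains_not_neutral)
  then show "x \<in> {\<gamma>1. \<exists>k1 k2. F \<gamma>1 k1 (\<gamma> - \<gamma>1) k2 \<noteq> 0}"
    by blast
qed

lemma diagonal_sum:
  assumes "antidiag_finite F"
  shows "diagonal F \<gamma> k = (\<Sum>k1\<le>k. Sum_any (\<lambda>\<gamma>1. F \<gamma>1 k1 (\<gamma> - \<gamma>1) (k - k1)))"
  unfolding diagonal_def by (rule Sum_any_sum) (simp_all add: antidiag_finite_term[OF assms])

lemma antidiag_finite_mult_z12:
  fixes F :: "'w::ab_group_add ser2"
  assumes "antidiag_finite F"
  shows "antidiag_finite (mult_z12 F)"
  unfolding antidiag_finite_def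
proof
  fix \<gamma>
  let ?S = "{\<gamma>1. \<exists>k1 k2. F \<gamma>1 k1 ((\<gamma> - 1) - \<gamma>1) k2 \<noteq> 0}"
  have "{\<gamma>1. \<exists>k1 k2. mult_z12 F \<gamma>1 k1 (\<gamma> - \<gamma>1) k2 \<noteq> 0} \<subseteq> (\<lambda>x. x + 1) ` ?S \<union> ?S"
  proof
    fix \<gamma>1 assume "\<gamma>1 \<in> {\<gamma>1. \<exists>k1 k2. mult_z12 F \<gamma>1 k1 (\<gamma> - \<gamma>1) k2 \<noteq> 0}"
    then obtain k1 k2 where "mult_z12 F \<gamma>1 k1 (\<gamma> - \<gamma>1) k2 \<noteq> 0"
      by auto
    moreover have "(\<gamma> - 1) - (\<gamma>1 - 1) = \<gamma> - \<gamma>1" "(\<gamma> - 1) - \<gamma>1 = \<gamma> - \<gamma>1 - 1"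
      by simp_all
    ultimately have "F (\<gamma>1 - 1) k1 ((\<gamma> - 1) - (\<gamma>1 - 1)) k2 \<noteq> 0 \<or> F \<gamma>1 k1 ((\<gamma> - 1) - \<gamma>1) k2 \<noteq> 0"
      using right_minus_eq unfolding mult_z12_def by metis
    then have "\<gamma>1 - 1 \<in> ?S \<or> \<gamma>1 \<in> ?S" by blast
    then show "\<gamma>1 \<in> (\<lambda>x. x + 1) ` ?S \<union> ?S"
      using image_eqI[of \<gamma>1 "\<lambda>x. x + 1" "\<gamma>1 - 1" ?S] by auto
  qed
  then show "finite {\<gamma>1. \<exists>k1 k2. mult_z12 F \<gamma>1 k1 (\<gamma> - \<gamma>1) k2 \<noteq> 0}"
    by (rule finite_subset) (use antidiag_finiteD[OF assms] in simp)
qed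

text \<open>Along an antidiagonal the contributions of \<open>z\<^sub>1F\<close> and \<open>z\<^sub>2F\<close> are shifts of each other.\<close>

lemma diagonal_mult_z12:
  fixes F :: "'w::ab_group_add ser2"
  assumes F: "antidiag_finite F"
  shows "diagonal (mult_z12 F) = (\<lambda>\<gamma> k. 0)"
proof (intro ext)
  fix \<gamma> k
  define f where "f \<gamma>1 = (\<Sum>k1\<le>k. F \<gamma>1 k1 (\<gamma> - 1 - \<gamma>1) (k - k1))" for \<gamma>1
  have fin: "finite {\<gamma>1. f \<gamma>1 \<noteq> 0}"
    unfolding f_def by (rule antidiag_finite_diagonal[OF F])
  have shift: "Sum_any f = Sum_any (\<lambda>x. f (x - 1))"
  proof (rule Sum_any_reindex)
    show "inj (\<lambda>x::complex. x - 1)" by (simp add: inj_def)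
    show "x \<in> range (\<lambda>x. x - 1)" for x :: complex
      by (metis add_diff_cancel_right' rangeI)
  qed
  have fin': "finite {x. f (x - 1) \<noteq> 0}"
    using finite_vimageI[OF fin, of "\<lambda>x. x - 1"] by (simp add: vimage_def inj_def)
  have "diagonal (mult_z12 F) \<gamma> k = Sum_any (\<lambda>x. f (x - 1) + - f x)"
    unfolding diagonal_def mult_z12_def f_def
    unfolding diff_diff_eq by (rule Sum_any.cong) (simp add: sum_subtractf add.commute[of 1])
  also have "\<dots> = Sum_any (\<lambda>x. f (x - 1)) + Sum_any (\<lambda>x. - f x)"
    by (rule Sum_any.distrib[OF fin']) (use fin in simp)
  also have "\<dots> = 0"
    unfolding shift[symmetric] by (simp add: Sum_any.expand_set sum_negf)
  finally show "diagonal (mult_z12 F) \<gamma> k = 0" .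
qed

lemma diagonal_add:
  assumes "antidiag_finite F" and "antidiag_finite G"
  shows "diagonal (\<lambda>\<gamma>1 k1 \<gamma>2 k2. F \<gamma>1 k1 \<gamma>2 k2 + G \<gamma>1 k1 \<gamma>2 k2) \<gamma> k
    = diagonal F \<gamma> k + diagonal G \<gamma> k"
  unfolding diagonal_def sum.distrib
  by (rule Sum_any.distrib[OF antidiag_finite_diagonal[OF assms(1)] antidiag_finite_diagonal[OF assms(2)]])

context complex_vector_space
begin

lemma antidiag_finite_D_z1:
  assumes "antidiag_finite F"
  shows "antidiag_finite (D_z1 scale F)"
  unfolding antidiag_finite_def
proof
  fix \<gamma>
  let ?S = "{\<gamma>1. \<exists>k1 k2. F \<gamma>1 k1 ((\<gamma> + 1) - \<gamma>1) k2 \<noteq> 0}"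
  have "{\<gamma>1. \<exists>k1 k2. D_z1 scale F \<gamma>1 k1 (\<gamma> - \<gamma>1) k2 \<noteq> 0} \<subseteq> (\<lambda>x. x - 1) ` ?S"
  proof
    fix \<gamma>1 assume "\<gamma>1 \<in> {\<gamma>1. \<exists>k1 k2. D_z1 scale F \<gamma>1 k1 (\<gamma> - \<gamma>1) k2 \<noteq> 0}"
    then obtain k1 k2 where "D_z1 scale F \<gamma>1 k1 (\<gamma> - \<gamma>1) k2 \<noteq> 0" by blast
    then have "F (\<gamma>1 + 1) k1 (\<gamma> - \<gamma>1) k2 \<noteq> 0 \<or> F (\<gamma>1 + 1) (Suc k1) (\<gamma> - \<gamma>1) k2 \<noteq> 0"
      by (auto simp: D_z1_def)
    moreover have "(\<gamma> + 1) - (\<gamma>1 + 1) = \<gamma> - \<gamma>1" by simp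
    ultimately obtain k1 k2 where "F (\<gamma>1 + 1) k1 ((\<gamma> + 1) - (\<gamma>1 + 1)) k2 \<noteq> 0"
      by metis
    then have "\<gamma>1 + 1 \<in> ?S" by blast
    then show "\<gamma>1 \<in> (\<lambda>x. x - 1) ` ?S"
      using image_eqI[of \<gamma>1 "\<lambda>x. x - 1" "\<gamma>1 + 1" ?S] by simp
  qed
  then show "finite {\<gamma>1. \<exists>k1 k2. D_z1 scale F \<gamma>1 k1 (\<gamma> - \<gamma>1) k2 \<noteq> 0}"
    by (rule finite_subset) (use antidiag_finiteD[OF assms] in simp)
qed

lemma antidiag_finite_scale:
  assumes "antidiag_finite F"
  shows "antidiag_finite (\<lambda>\<gamma>1 k1 \<gamma>2 k2. scale c (F \<gamma>1 k1 \<gamma>2 k2))"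
  unfolding antidiag_finite_def
  by (intro allI finite_subset[OF _ antidiag_finiteD[OF assms]]) auto

lemma antidiag_finite_divided_power:
  assumes "antidiag_finite F"
  shows "antidiag_finite (divided_power scale (D_z1 scale) i F)"
proof -
  have "antidiag_finite ((D_z1 scale ^^ i) F)"
    by (induction i) (simp_all add: assms antidiag_finite_D_z1)
  then show ?thesis
    unfolding divided_power_def by (rule antidiag_finite_scale)
qed

lemma diagonal_scale:
  assumes "antidiag_finite F"
  shows "diagonal (\<lambda>\<gamma>1 k1 \<gamma>2 k2. scale c (F \<gamma>1 k1 \<gamma>2 k2)) \<gamma> k = scale c (diagonal F \<gamma> k)"
  unfolding diagonal_def
  by (subst Sum_any_additive[of "scale c"])
    (simp_all add: scale_right_distrib scale_sum_right antidiag_finite_diagonal[OF assms])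

lemma D_z1_add:
  "D_z1 scale (\<lambda>\<gamma>1 k1 \<gamma>2 k2. F \<gamma>1 k1 \<gamma>2 k2 + G \<gamma>1 k1 \<gamma>2 k2)
    = (\<lambda>\<gamma>1 k1 \<gamma>2 k2. D_z1 scale F \<gamma>1 k1 \<gamma>2 k2 + D_z1 scale G \<gamma>1 k1 \<gamma>2 k2)"
  by (intro ext) (simp add: D_z1_def scale_right_distrib algebra_simps)

lemma D_z1_scale:
  "D_z1 scale (\<lambda>\<gamma>1 k1 \<gamma>2 k2. scale c (F \<gamma>1 k1 \<gamma>2 k2))
    = (\<lambda>\<gamma>1 k1 \<gamma>2 k2. scale c (D_z1 scale F \<gamma>1 k1 \<gamma>2 k2))"
  by (intro ext) (simp add: D_z1_def scale_right_distrib mult.commute)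

lemma D_z1_mult_z12:
  "D_z1 scale (mult_z12 F)
    = (\<lambda>\<gamma>1 k1 \<gamma>2 k2. mult_z12 (D_z1 scale F) \<gamma>1 k1 \<gamma>2 k2 + F \<gamma>1 k1 \<gamma>2 k2)"
  by (intro ext) (simp add: D_z1_def mult_z12_def scale_right_distrib scale_right_diff_distrib
      scale_left_distrib algebra_simps)

lemma divided_power_Suc:
  "divided_power scale (D_z1 scale) (Suc i) F
    = (\<lambda>\<gamma>1 k1 \<gamma>2 k2. scale (1 / of_nat (Suc i))
        (D_z1 scale (divided_power scale (D_z1 scale) i F) \<gamma>1 k1 \<gamma>2 k2))"
  unfolding divided_power_def D_z1_scale by (simp add: mult.commute)

text \<open>The product rule for divided powers, as \<open>D z\<^sub>1\<^sub>2 = 1\<close>.  The first summand vanishes on the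
  diagonal, which is why the \<open>n\<close>-th product does not depend on the order of locality.\<close>

lemma divided_power_Suc_mult_z12:
  "divided_power scale (D_z1 scale) (Suc i) (mult_z12 F)
    = (\<lambda>\<gamma>1 k1 \<gamma>2 k2. mult_z12 (divided_power scale (D_z1 scale) (Suc i) F) \<gamma>1 k1 \<gamma>2 k2
        + divided_power scale (D_z1 scale) i F \<gamma>1 k1 \<gamma>2 k2)"
proof (induction i)
  case 0
  show ?case
    unfolding divided_power_Suc by (simp add: divided_power_def D_z1_mult_z12)
next
  case (Suc i)
  let ?D = "\<lambda>i. divided_power scale (D_z1 scale) i F"
  let ?c = "1 / of_nat (Suc (Suc i)) :: complex"
  have D_Suc: "D_z1 scale (?D i) \<gamma>1 k1 \<gamma>2 k2 = scale (of_nat (Suc i)) (?D (Suc i) \<gamma>1 k1 \<gamma>2 k2)"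
    for i \<gamma>1 k1 \<gamma>2 k2
    by (simp add: divided_power_Suc del: of_nat_Suc)
  have c: "scale ?c x + scale (?c * of_nat (Suc i)) x = x" for x
  proof -
    have "?c + ?c * of_nat (Suc i) = ?c * of_nat (Suc (Suc i))"
      by (simp only: of_nat_Suc[of "Suc i"] distrib_left mult_1_right)
    also have "\<dots> = 1"
      by (simp del: of_nat_Suc)
    finally have "?c + ?c * of_nat (Suc i) = 1" .
    then show ?thesis
      by (metis scale_left_distrib scale_one)
  qed
  show ?case
  proof (intro ext)
    fix \<gamma>1 k1 \<gamma>2 k2
    have "divided_power scale (D_z1 scale) (Suc (Suc i)) (mult_z12 F) \<gamma>1 k1 \<gamma>2 k2
        = scale ?c (mult_z12 (D_z1 scale (?D (Suc i))) \<gamma>1 k1 \<gamma>2 k2 + ?D (Suc i) \<gamma>1 k1 \<gamma>2 k2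
            + D_z1 scale (?D i) \<gamma>1 k1 \<gamma>2 k2)"
      by (subst divided_power_Suc) (simp only: Suc.IH D_z1_add D_z1_mult_z12)
    also have "\<dots> = scale ?c (mult_z12 (D_z1 scale (?D (Suc i))) \<gamma>1 k1 \<gamma>2 k2)
        + (scale ?c (?D (Suc i) \<gamma>1 k1 \<gamma>2 k2)
            + scale (?c * of_nat (Suc i)) (?D (Suc i) \<gamma>1 k1 \<gamma>2 k2))"
      unfolding D_Suc by (simp only: scale_right_distrib scale_scale add.assoc)
    also have "\<dots> = mult_z12 (?D (Suc (Suc i))) \<gamma>1 k1 \<gamma>2 k2 + ?D (Suc i) \<gamma>1 k1 \<gamma>2 k2"
      unfolding c divided_power_Suc[of "Suc i"]
      by (simp only: mult_z12_def scale_right_diff_distrib)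
    finally show "divided_power scale (D_z1 scale) (Suc (Suc i)) (mult_z12 F) \<gamma>1 k1 \<gamma>2 k2
        = mult_z12 (?D (Suc (Suc i))) \<gamma>1 k1 \<gamma>2 k2 + ?D (Suc i) \<gamma>1 k1 \<gamma>2 k2" .
  qed
qed

lemma diagonal_divided_power_mult_z12:
  assumes "antidiag_finite F"
  shows "diagonal (divided_power scale (D_z1 scale) (Suc i) (mult_z12 F))
    = diagonal (divided_power scale (D_z1 scale) i F)"
  by (intro ext)
    (simp add: divided_power_Suc_mult_z12 diagonal_add antidiag_finite_mult_z12
      antidiag_finite_divided_power assms diagonal_mult_z12)

text \<open>For \<open>F = z\<^sub>1\<^sub>2\<^sup>Ma(z\<^sub>1)b(z\<^sub>2)v\<close> this is \<open>(a\<^sub>(\<^sub>n\<^sub>)b)(z)v\<close>, computed with the order \<open>M\<close> of locality.\<close>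

definition product_from_order :: "nat \<Rightarrow> int \<Rightarrow> 'b ser2 \<Rightarrow> 'b ser" where
  "product_from_order M n F = (if n < int M
     then diagonal (divided_power scale (D_z1 scale) (nat (int M - 1 - n)) F) else (\<lambda>\<gamma> k. 0))"

lemma product_from_order_mult_z12:
  assumes "antidiag_finite F"
  shows "product_from_order (M + t) n ((mult_z12 ^^ t) F) = product_from_order M n F"
proof (induction t)
  case (Suc t)
  let ?F = "(mult_z12 ^^ t) F"
  have fin: "antidiag_finite ?F"
    by (induction t) (simp_all add: assms antidiag_finite_mult_z12)
  have "product_from_order (Suc (M + t)) n (mult_z12 ?F) = product_from_order (M + t) n ?F"
  proof (cases "n < int (M + t)")
    case True
    then have "nat (int (Suc (M + t)) - 1 - n) = Suc (nat (int (M + t) - 1 - n))"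
      by simp
    with True show ?thesis
      by (simp add: product_from_order_def diagonal_divided_power_mult_z12[OF fin])
  next
    case False
    then show ?thesis
      by (auto simp: product_from_order_def divided_power_def diagonal_mult_z12[OF fin])
  qed
  with Suc show ?case by simp
qed simp

end


section \<open>Exponents and products of logarithmic fields\<close>

text \<open>Elements of \<^const>\<open>LFie\<close> mix finitely many cosets of exponents, so being bounded below means
  lying in finitely many sets \<open>\<beta> + \<nat>\<close>.\<close>

definition exponents_bounded :: "complex set \<Rightarrow> bool" where
  "exponents_bounded S \<longleftrightarrow> (\<exists>B. finite B \<and> S \<subseteq> (\<Union>\<beta>\<in>B. range (\<lambda>i. \<beta> + of_nat i)))"

lemma finite_antidiagonal_of_exponents_bounded:
  assumes "exponents_bounded S" and "exponents_bounded T"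
  shows "finite {x. x \<in> S \<and> \<gamma> - x \<in> T}"
proof -
  obtain B C where B: "finite B" "S \<subseteq> (\<Union>\<beta>\<in>B. range (\<lambda>i. \<beta> + of_nat i))"
    and C: "finite C" "T \<subseteq> (\<Union>\<beta>\<in>C. range (\<lambda>i. \<beta> + of_nat i))"
    using assms unfolding exponents_bounded_def by blast
  \<comment> \<open>If \<open>x = \<beta> + i\<close> and \<open>\<gamma> - x = \<beta>' + i'\<close>, then \<open>i + i'\<close> is the real part of \<open>\<gamma> - \<beta> - \<beta>'\<close>.\<close>
  have "{x. x \<in> S \<and> \<gamma> - x \<in> T}
      \<subseteq> (\<Union>\<beta>\<in>B. \<Union>\<beta>'\<in>C. (\<lambda>i. \<beta> + of_nat i) ` {..nat \<lceil>Re (\<gamma> - \<beta> - \<beta>')\<rceil>})"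
  proof
    fix x assume "x \<in> {x. x \<in> S \<and> \<gamma> - x \<in> T}"
    then obtain \<beta> \<beta>' i i' where *: "\<beta> \<in> B" "\<beta>' \<in> C" "x = \<beta> + of_nat i" "\<gamma> - x = \<beta>' + of_nat i'"
      using B C by blast
    then have "\<gamma> - \<beta> - \<beta>' = of_nat i + of_nat i'"
      by (simp add: algebra_simps)
    then have "Re (\<gamma> - \<beta> - \<beta>') = of_nat i + of_nat i'"
      by simp
    then have "i \<le> nat \<lceil>Re (\<gamma> - \<beta> - \<beta>')\<rceil>"
      by linarith
    with * show "x \<in> (\<Union>\<beta>\<in>B. \<Union>\<beta>'\<in>C. (\<lambda>i. \<beta> + of_nat i) ` {..nat \<lceil>Re (\<gamma> - \<beta> - \<beta>')\<rceil>})"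
      by blast
  qed
  then show ?thesis
    by (rule finite_subset) (use B C in simp)
qed

lemma finite_descending_of_exponents_bounded:
  assumes "exponents_bounded S"
  shows "finite {i::nat. \<gamma> - of_nat i \<in> S}"
proof -
  have nats: "exponents_bounded (range of_nat)"
    unfolding exponents_bounded_def by (rule exI[of _ "{0}"]) auto
  have "(\<lambda>i. of_nat i :: complex) ` {i. \<gamma> - of_nat i \<in> S} \<subseteq> {x. x \<in> range of_nat \<and> \<gamma> - x \<in> S}"
    by auto
  then have "finite ((\<lambda>i. of_nat i :: complex) ` {i. \<gamma> - of_nat i \<in> S})"
    using finite_antidiagonal_of_exponents_bounded[OF nats assms] by (rule finite_subset)
  then show ?thesis
    by (rule finite_imageD) (simp add: inj_on_def)
qed

lemma mult_z12_funpow_support: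
  fixes F :: "'w::ab_group_add ser2"
  assumes "(mult_z12 ^^ M) F \<gamma>1 k1 \<gamma>2 k2 \<noteq> 0"
  shows "\<exists>i\<le>M. F (\<gamma>1 - of_nat i) k1 (\<gamma>2 - of_nat (M - i)) k2 \<noteq> 0"
  using assms
proof (induction M arbitrary: \<gamma>1 \<gamma>2)
  case (Suc M)
  have "(mult_z12 ^^ Suc M) F \<gamma>1 k1 \<gamma>2 k2
      = (mult_z12 ^^ M) F (\<gamma>1 - 1) k1 \<gamma>2 k2 - (mult_z12 ^^ M) F \<gamma>1 k1 (\<gamma>2 - 1) k2"
    by (simp add: mult_z12_def)
  with Suc.prems consider "(mult_z12 ^^ M) F (\<gamma>1 - 1) k1 \<gamma>2 k2 \<noteq> 0"
    | "(mult_z12 ^^ M) F \<gamma>1 k1 (\<gamma>2 - 1) k2 \<noteq> 0"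
    by fastforce
  then show ?case
  proof cases
    case 1
    then obtain i where "i \<le> M" "F (\<gamma>1 - 1 - of_nat i) k1 (\<gamma>2 - of_nat (M - i)) k2 \<noteq> 0"
      using Suc.IH by blast
    then show ?thesis
      by (intro exI[of _ "Suc i"]) (simp add: diff_diff_eq)
  next
    case 2
    then obtain i where "i \<le> M" "F (\<gamma>1 - of_nat i) k1 (\<gamma>2 - 1 - of_nat (M - i)) k2 \<noteq> 0"
      using Suc.IH by blast
    then show ?thesis
      by (intro exI[of _ i]) (simp add: diff_diff_eq Suc_diff_le)
  qed
qed auto

lemma exponents_bounded_shift:
  assumes "exponents_bounded S"
  shows "exponents_bounded {x. \<exists>i::nat. x - of_nat i \<in> S}"
proof -
  obtain B where B: "finite B" "S \<subseteq> (\<Union>\<beta>\<in>B. range (\<lambda>i. \<beta> + of_nat i))"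
    using assms unfolding exponents_bounded_def by blast
  have "{x. \<exists>i::nat. x - of_nat i \<in> S} \<subseteq> (\<Union>\<beta>\<in>B. range (\<lambda>i. \<beta> + of_nat i))"
  proof
    fix x assume "x \<in> {x. \<exists>i::nat. x - of_nat i \<in> S}"
    then obtain i :: nat where "x - of_nat i \<in> S" by blast
    then obtain \<beta> j where "\<beta> \<in> B" "x - of_nat i = \<beta> + of_nat j"
      using B by blast
    moreover from this have "x = \<beta> + of_nat (i + j)"
      by (simp add: algebra_simps)
    ultimately show "x \<in> (\<Union>\<beta>\<in>B. range (\<lambda>i. \<beta> + of_nat i))"
      by blast
  qed
  with B(1) show ?thesis
    unfolding exponents_bounded_def by blast
qed

context complex_vector_space
begin

lemma LFie_linear:
  assumes "a \<in> LFie scale"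
  shows "Vector_Spaces.linear scale scale (\<lambda>v. a v \<gamma> k)"
proof -
  obtain A f where A: "finite A" "\<forall>\<alpha>\<in>A. f \<alpha> \<in> LFie_comp scale \<alpha>"
    "a = (\<lambda>v \<gamma> k. \<Sum>\<alpha>\<in>A. f \<alpha> v \<gamma> k)"
    using assms unfolding LFie_def by blast
  have lin: "Vector_Spaces.linear scale scale (\<lambda>v. f \<alpha> v \<gamma> k)" if "\<alpha> \<in> A" for \<alpha>
    using A(2) that by (auto simp: LFie_comp_def)
  show ?thesis
    unfolding Vector_Spaces.linear_iff A(3) scale_sum_right sum.distrib[symmetric]
    by (intro conjI allI vector_space_axioms sum.cong refl)
      (simp_all add: linear_props(1)[OF lin] linear_props(2)[OF lin])
qed

lemma LFie_exponents_bounded: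
  assumes "a \<in> LFie scale"
  shows "exponents_bounded {\<gamma>. \<exists>k. a v \<gamma> k \<noteq> 0}"
proof -
  obtain A f where A: "finite A" "\<forall>\<alpha>\<in>A. f \<alpha> \<in> LFie_comp scale \<alpha>"
    "a = (\<lambda>v \<gamma> k. \<Sum>\<alpha>\<in>A. f \<alpha> v \<gamma> k)"
    using assms unfolding LFie_def by blast
  have "\<exists>m. \<forall>\<gamma> k. f \<alpha> v \<gamma> k \<noteq> 0 \<longrightarrow> (\<exists>i::nat. \<gamma> = of_nat i - m)" if "\<alpha> \<in> A" for \<alpha>
  proof -
    have "f \<alpha> v \<in> log_series \<alpha>"
      using A(2) that by (simp add: LFie_comp_def)
    then show ?thesis
      unfolding log_series_def by blast
  qed
  then obtain m where m: "\<And>\<alpha> \<gamma> k. \<alpha> \<in> A \<Longrightarrow> f \<alpha> v \<gamma> k \<noteq> 0 \<Longrightarrow> \<exists>i::nat. \<gamma> = of_nat i - m \<alpha>"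
    by metis
  have "{\<gamma>. \<exists>k. a v \<gamma> k \<noteq> 0} \<subseteq> (\<Union>\<beta>\<in>(\<lambda>\<alpha>. - m \<alpha>) ` A. range (\<lambda>i. \<beta> + of_nat i))"
  proof
    fix \<gamma> assume "\<gamma> \<in> {\<gamma>. \<exists>k. a v \<gamma> k \<noteq> 0}"
    then obtain k where "(\<Sum>\<alpha>\<in>A. f \<alpha> v \<gamma> k) \<noteq> 0"
      unfolding A(3) by blast
    then obtain \<alpha> where "\<alpha> \<in> A" "f \<alpha> v \<gamma> k \<noteq> 0"
      by (rule sum.not_neutral_contains_not_neutral)
    with m[of \<alpha> \<gamma> k] obtain i :: nat where "\<alpha> \<in> A" "\<gamma> = - m \<alpha> + of_nat i"
      by auto
    then show "\<gamma> \<in> (\<Union>\<beta>\<in>(\<lambda>\<alpha>. - m \<alpha>) ` A. range (\<lambda>i. \<beta> + of_nat i))"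
      by (intro UN_I[of "- m \<alpha>"] imageI) simp_all
  qed
  with A(1) show ?thesis
    unfolding exponents_bounded_def
    by (intro exI[of _ "(\<lambda>\<alpha>. - m \<alpha>) ` A"]) simp
qed

lemma LFie_finite_log:
  assumes "a \<in> LFie scale"
  shows "finite {k. a v \<gamma> k \<noteq> 0}"
proof -
  obtain A f where A: "finite A" "\<forall>\<alpha>\<in>A. f \<alpha> \<in> LFie_comp scale \<alpha>"
    "a = (\<lambda>v \<gamma> k. \<Sum>\<alpha>\<in>A. f \<alpha> v \<gamma> k)"
    using assms unfolding LFie_def by blast
  have fin: "finite {k. f \<alpha> v \<gamma> k \<noteq> 0}" if "\<alpha> \<in> A" for \<alpha>
    using A(2) that by (auto simp: LFie_comp_def log_series_def)
  have "{k. a v \<gamma> k \<noteq> 0} \<subseteq> (\<Union>\<alpha>\<in>A. {k. f \<alpha> v \<gamma> k \<noteq> 0})"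
    unfolding A(3) by (auto elim: sum.not_neutral_contains_not_neutral)
  then show ?thesis
    by (rule finite_subset) (use A(1) fin in blast)
qed

lemma comp12_support:
  assumes "a \<in> LFie scale" and "comp12 a b v \<gamma>1 k1 \<gamma>2 k2 \<noteq> 0"
  shows "b v \<gamma>2 k2 \<noteq> 0" "a (b v \<gamma>2 k2) \<gamma>1 k1 \<noteq> 0"
  using assms(2) linear_props(3)[OF LFie_linear[OF assms(1)]] by (auto simp: comp12_def)

lemma comp21_support:
  assumes "b \<in> LFie scale" and "comp21 b a v \<gamma>1 k1 \<gamma>2 k2 \<noteq> 0"
  shows "a v \<gamma>1 k1 \<noteq> 0"
  using assms(2) linear_props(3)[OF LFie_linear[OF assms(1)]] by (auto simp: comp21_def)

lemma lower_bounded2_comp12: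
  assumes "a \<in> LFie scale" and "b \<in> LFie scale"
  shows "lower_bounded2 (comp12 a b v)"
  unfolding lower_bounded2_def
proof (intro allI)
  fix \<gamma>1 k1 \<gamma>2 k2
  show "finite {i::nat. comp12 a b v (\<gamma>1 + of_nat i) k1 (\<gamma>2 - of_nat i) k2 \<noteq> 0}"
    by (rule finite_subset[OF _ finite_descending_of_exponents_bounded[OF
            LFie_exponents_bounded[OF assms(2), of v], of \<gamma>2]])
      (auto dest: comp12_support(1)[OF assms(1)])
qed

lemma lower_bounded1_comp21:
  assumes "a \<in> LFie scale" and "b \<in> LFie scale"
  shows "lower_bounded1 (comp21 b a v)"
  unfolding lower_bounded1_def lower_bounded2_def swap_series_def
proof (intro allI)
  fix \<gamma>1 k1 \<gamma>2 k2
  show "finite {i::nat. comp21 b a v (\<gamma>2 - of_nat i) k2 (\<gamma>1 + of_nat i) k1 \<noteq> 0}"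
    by (rule finite_subset[OF _ finite_descending_of_exponents_bounded[OF
            LFie_exponents_bounded[OF assms(1), of v], of \<gamma>2]])
      (auto dest: comp21_support[OF assms(2)])
qed

text \<open>Applying \<open>a(z\<^sub>1)b(z\<^sub>2)\<close> to \<open>v\<close> bounds the exponents of \<open>z\<^sub>2\<close> from below, and \<open>b(z\<^sub>2)a(z\<^sub>1)\<close>
  those of \<open>z\<^sub>1\<close>.  Locality gives both bounds to the same series.\<close>

lemma antidiag_finite_local:
  assumes a: "a \<in> LFie scale" and b: "b \<in> LFie scale" and loc: "local_of_order M a b"
  shows "antidiag_finite ((mult_z12 ^^ M) (comp12 a b v))"
  unfolding antidiag_finite_def
proof
  fix \<gamma>
  let ?F = "(mult_z12 ^^ M) (comp12 a b v)"
  let ?S = "{x. \<exists>i::nat. x - of_nat i \<in> {\<gamma>. \<exists>k. a v \<gamma> k \<noteq> 0}}"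
  let ?T = "{x. \<exists>i::nat. x - of_nat i \<in> {\<gamma>. \<exists>k. b v \<gamma> k \<noteq> 0}}"
  have F21: "?F = (mult_z12 ^^ M) (comp21 b a v)"
    using loc by (simp add: local_of_order_def)
  have "{\<gamma>1. \<exists>k1 k2. ?F \<gamma>1 k1 (\<gamma> - \<gamma>1) k2 \<noteq> 0} \<subseteq> {x. x \<in> ?S \<and> \<gamma> - x \<in> ?T}"
  proof
    fix x assume "x \<in> {\<gamma>1. \<exists>k1 k2. ?F \<gamma>1 k1 (\<gamma> - \<gamma>1) k2 \<noteq> 0}"
    then obtain k1 k2 where F: "?F x k1 (\<gamma> - x) k2 \<noteq> 0" by blast
    obtain i where "comp12 a b v (x - of_nat i) k1 (\<gamma> - x - of_nat (M - i)) k2 \<noteq> 0"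
      using mult_z12_funpow_support[OF F] by blast
    then have "\<gamma> - x \<in> ?T"
      using comp12_support(1)[OF a] by blast
    moreover obtain i where "comp21 b a v (x - of_nat i) k1 (\<gamma> - x - of_nat (M - i)) k2 \<noteq> 0"
      using mult_z12_funpow_support[OF F[unfolded F21]] by blast
    then have "x \<in> ?S"
      using comp21_support[OF b] by blast
    ultimately show "x \<in> {x. x \<in> ?S \<and> \<gamma> - x \<in> ?T}" by blast
  qed
  then show "finite {\<gamma>1. \<exists>k1 k2. ?F \<gamma>1 k1 (\<gamma> - \<gamma>1) k2 \<noteq> 0}"
    by (rule finite_subset) (intro finite_antidiagonal_of_exponents_bounded
        exponents_bounded_shift LFie_exponents_bounded a b)
qed

text \<open>The definition uses the least order of locality; raising it to a given order \<open>M\<close> multiplies the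
  series by a power of \<open>z\<^sub>1\<^sub>2\<close>, which the additional derivatives undo.\<close>

lemma lprod_from_order:
  assumes "a \<in> LFie scale" and "b \<in> LFie scale" and "local_of_order M a b"
  shows "lprod scale a n b v = product_from_order M n ((mult_z12 ^^ M) (comp12 a b v))"
proof -
  define L where "L = (LEAST N. local_of_order N a b)"
  have L: "local_of_order L a b" "L \<le> M"
    unfolding L_def using assms(3) by (auto intro: LeastI Least_le)
  then have M: "M = L + (M - L)" by simp
  have "lprod scale a n b v = product_from_order L n ((mult_z12 ^^ L) (comp12 a b v))"
    by (auto simp: lprod_def product_from_order_def L_def[symmetric] Let_def)
  also have "\<dots> = product_from_order (L + (M - L)) n
      ((mult_z12 ^^ (M - L)) ((mult_z12 ^^ L) (comp12 a b v)))"
    by (rule product_from_order_mult_z12[symmetric])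
      (rule antidiag_finite_local[OF assms(1,2) L(1)])
  also have "(mult_z12 ^^ (M - L)) ((mult_z12 ^^ L) (comp12 a b v))
      = (mult_z12 ^^ M) (comp12 a b v)"
    using L(2) by (simp flip: funpow_add comp_apply[of "mult_z12 ^^ (M - L)"])
  finally show ?thesis
    using M by simp
qed

end


section \<open>Exponentials and cosets of the integers\<close>

lemma CmodZ_nonempty: "\<alpha> \<in> CmodZ \<Longrightarrow> \<exists>m. m \<in> \<alpha>"
proof -
  assume "\<alpha> \<in> CmodZ"
  then obtain x where "\<alpha> = {y. x - y \<in> \<int>}"
    by (auto simp: CmodZ_def quotient_def)
  then have "x \<in> \<alpha>" by simp
  then show ?thesis by blast
qed

lemma power_sign_shift: "t ^ k * ((-1) ^ j / x) = (- t) ^ k * (-1) ^ (j + k) / x" for t x :: complex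
proof -
  have "(-1) ^ k * (-1) ^ k = (1 :: complex)"
    by (simp flip: power_mult_distrib)
  moreover have "(- t) ^ k * (-1) ^ (j + k) = t ^ k * (-1) ^ j * ((-1) ^ k * (-1) ^ k)"
    unfolding power_minus[of t] power_add by (simp only: mult_ac)
  ultimately show ?thesis by simp
qed

lemma exp_2pi_i_eq_iff:
  "exp (2 * of_real pi * \<i> * x) = exp (2 * of_real pi * \<i> * y) \<longleftrightarrow> x - y \<in> \<int>"
proof -
  have "exp (2 * of_real pi * \<i> * x) = exp (2 * of_real pi * \<i> * y)
      \<longleftrightarrow> (\<exists>n::int. 2 * of_real pi * \<i> * x = 2 * of_real pi * \<i> * (y + of_int n))"
    unfolding exp_eq by (simp add: algebra_simps)
  also have "\<dots> \<longleftrightarrow> (\<exists>n::int. x = y + of_int n)"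
    by simp
  also have "\<dots> \<longleftrightarrow> x - y \<in> \<int>"
    by (auto simp: Ints_def algebra_simps)
  finally show ?thesis .
qed


section \<open>Equivariance and logarithms\<close>

locale twisted_borcherds_map =
  fixes sV :: "complex \<Rightarrow> 'v::ab_group_add \<Rightarrow> 'v"
    and vac :: 'v
    and pr :: "'v \<Rightarrow> int \<Rightarrow> 'v \<Rightarrow> 'v"
    and \<sigma> \<N> :: "'v \<Rightarrow> 'v"
    and sW :: "complex \<Rightarrow> 'w::ab_group_add \<Rightarrow> 'w"
    and Y :: "'v \<Rightarrow> 'w lfield"
  assumes VA: "vertex_algebra sV vac pr"
    and \<sigma>_Aut: "\<sigma> \<in> Aut_VA sV pr" and \<sigma>_semisimple: "semisimple_op sV \<sigma>"
    and \<N>_Der: "\<N> \<in> Der_VA sV pr" and \<N>_nilpotent: "locally_nilpotent \<N>"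
    and \<sigma>_\<N>: "\<sigma> \<circ> \<N> = \<N> \<circ> \<sigma>"
    and W_space: "vector_space sW"
    and Y_linear_to_LFie: "linear_to_LFie sV sW Y"
    and Y_equivariant: "equivariant sW (\<sigma> \<circ> exp_op sV (- 2 * of_real pi * \<i>) \<N>) Y"
    and Y_borcherds: "twisted_borcherds sV pr \<sigma> \<N> sW Y"
begin

sublocale V: complex_vector_space sV
  using VA by (simp add: vertex_algebra_def complex_vector_space_def)

sublocale W: complex_vector_space sW
  using W_space by (simp add: complex_vector_space_def)

lemma Y_LFie: "Y a \<in> LFie sW"
  using Y_linear_to_LFie by (simp add: linear_to_LFie_def)

lemma Y_linear: "Vector_Spaces.linear sV sW (\<lambda>a. Y a v \<gamma> k)"
  using Y_linear_to_LFie by (simp add: linear_to_LFie_def)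

lemma Y_zero [simp]: "Y 0 v \<gamma> k = 0"
  by (rule linear_props(3)[OF Y_linear])

lemmas Y_linear_arg = W.LFie_linear[OF Y_LFie]

lemma pr_linear: "Vector_Spaces.linear sV sV (\<lambda>a. pr a n b)" "Vector_Spaces.linear sV sV (\<lambda>b. pr a n b)"
  using VA by (simp_all add: vertex_algebra_def vertex_algebra_axioms_def)

lemma pr_truncation: "\<exists>N. \<forall>n\<ge>N. pr a n b = 0"
  using VA unfolding vertex_algebra_def vertex_algebra_axioms_def by blast

lemma \<sigma>_linear: "Vector_Spaces.linear sV sV \<sigma>"
  using \<sigma>_Aut by (simp add: Aut_VA_def)

lemma \<N>_linear: "Vector_Spaces.linear sV sV \<N>"
  using \<N>_Der by (simp add: Der_VA_def)

lemma \<N>_derivation: "\<N> (pr a n b) = pr (\<N> a) n b + pr a n (\<N> b)"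
  using \<N>_Der by (simp add: Der_VA_def)

lemma \<N>_pow_linear: "Vector_Spaces.linear sV sV (\<N> ^^ k)"
proof (induction k)
  case (Suc k)
  then show ?case
    unfolding Vector_Spaces.linear_iff by (simp add: linear_props[OF \<N>_linear])
qed (simp add: Vector_Spaces.linear_iff V.vector_space_axioms)

lemma \<N>_pow_vanishes: "\<exists>l. \<forall>k\<ge>l. (\<N> ^^ k) a = 0"
proof -
  obtain l where l: "(\<N> ^^ l) a = 0"
    using \<N>_nilpotent unfolding locally_nilpotent_def by blast
  have "(\<N> ^^ (k + l)) a = 0" for k
    by (simp add: funpow_add l linear_props(3)[OF \<N>_pow_linear])
  then show ?thesis
    by (metis le_add_diff_inverse2)
qed

lemma \<N>_pow_pow: "(\<N> ^^ i) ((\<N> ^^ j) a) = (\<N> ^^ (i + j)) a"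
  by (simp add: funpow_add)

lemma \<N>_pow_vanishes_above: "(\<N> ^^ Suc l) a = 0 \<Longrightarrow> (\<N> ^^ l) ((\<N> ^^ Suc k) a) = 0"
  using \<N>_pow_pow[of k "Suc l" a] linear_props(3)[OF \<N>_pow_linear, of k]
  by (simp only: \<N>_pow_pow add_Suc_right add.commute)

abbreviation eigen :: "complex set \<Rightarrow> 'v set" where
  "eigen \<equiv> eigen_component sV \<sigma>"

lemma eigen_subspace: "V.subspace (eigen \<alpha>)"
  by (rule V.subspaceI)
    (simp_all add: eigen_component_def linear_props[OF \<sigma>_linear] V.scale_right_distrib mult.commute)

lemma eigen_\<N>: "a \<in> eigen \<alpha> \<Longrightarrow> \<N> a \<in> eigen \<alpha>"
  using \<sigma>_\<N> by (auto simp: eigen_component_def fun_eq_iff linear_props[OF \<N>_linear])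

lemma eigen_\<N>_pow: "a \<in> eigen \<alpha> \<Longrightarrow> (\<N> ^^ k) a \<in> eigen \<alpha>"
  by (induction k) (simp_all add: eigen_\<N>)

text \<open>An eigenvector of \<open>\<sigma>\<close> with eigenvalue \<open>c \<noteq> 0\<close> lies in \<open>V\<^sub>\<alpha>\<close> for \<open>\<alpha>\<close> the coset of
  \<open>-(ln c)/2\<pi>i\<close>; for \<open>c = 0\<close> the vector is \<open>0\<close>, as \<open>\<sigma>\<close> is injective.\<close>

lemma span_eigen: "V.span (\<Union>\<alpha>\<in>CmodZ. eigen \<alpha>) = UNIV"
proof -
  have "{a. \<exists>c. \<sigma> a = sV c a} \<subseteq> (\<Union>\<alpha>\<in>CmodZ. eigen \<alpha>)"
  proof
    fix a assume "a \<in> {a. \<exists>c. \<sigma> a = sV c a}"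
    then obtain c where c: "\<sigma> a = sV c a" by blast
    have coset: "{y. m - y \<in> \<int>} \<in> CmodZ" for m :: complex
      unfolding CmodZ_def by (rule quotientI[of m UNIV "{(x, y). x - y \<in> \<int>}", simplified Image_def, simplified])
    show "a \<in> (\<Union>\<alpha>\<in>CmodZ. eigen \<alpha>)"
    proof (cases "c = 0")
      case True
      then have "\<sigma> a = \<sigma> 0"
        by (simp add: c linear_props(3)[OF \<sigma>_linear])
      moreover have "inj \<sigma>"
        using \<sigma>_Aut by (simp add: Aut_VA_def bij_def)
      ultimately have "a = 0"
        by (simp add: inj_eq)
      then show ?thesis
        using coset[of 0] V.subspace_0[OF eigen_subspace] by blast
    next
      case False
      define m where "m = - Ln c / (2 * of_real pi * \<i>)"
      have exp_m: "exp (2 * of_real pi * \<i> * (- m)) = c"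
        using False by (simp add: m_def)
      have "exp (- 2 * of_real pi * \<i> * y) = c" if "m - y \<in> \<int>" for y
        using exp_2pi_i_eq_iff[of "- y" "- m"] that exp_m by simp
      then have "a \<in> eigen {y. m - y \<in> \<int>}"
        using c by (simp add: eigen_component_def)
      then show ?thesis
        using coset by blast
    qed
  qed
  then have "V.span {a. \<exists>c. \<sigma> a = sV c a} \<subseteq> V.span (\<Union>\<alpha>\<in>CmodZ. eigen \<alpha>)"
    by (rule V.span_mono)
  then show ?thesis
    using \<sigma>_semisimple by (auto simp: semisimple_op_def)
qed

text \<open>Equivariance for \<open>\<sigma> e\<^bsup>-2\<pi>i\<N>\<^esup>a\<close>, compared at \<open>z\<^sup>\<gamma>\<zeta>\<^sup>j\<close>.\<close>

lemma equivariance_coefficient: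
  assumes a: "a \<in> eigen \<alpha>" and m: "m \<in> \<alpha>" and l: "\<And>k. k \<ge> l \<Longrightarrow> (\<N> ^^ k) a = 0"
  shows "sW (exp (2 * of_real pi * \<i> * \<gamma>))
      (Sum_any (\<lambda>i. sW (of_nat (i choose j) * (2 * of_real pi * \<i>) ^ (i - j)) (Y a v \<gamma> i)))
    = sW (exp (2 * of_real pi * \<i> * (- m)))
      (\<Sum>k<l. sW ((- 2 * of_real pi * \<i>) ^ k / fact k) (Y ((\<N> ^^ k) a) v \<gamma> j))"
proof -
  let ?t = "- 2 * of_real pi * \<i>"
  let ?c = "exp (2 * of_real pi * \<i> * (- m))"
  have "exp_op sV ?t \<N> a = (\<Sum>k<l. sV (?t ^ k / fact k) ((\<N> ^^ k) a))"
    unfolding exp_op_def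
    by (rule Sum_any_lessThan) (simp add: l)
  then have "(\<sigma> \<circ> exp_op sV ?t \<N>) a = (\<Sum>k<l. sV (?t ^ k / fact k) (\<sigma> ((\<N> ^^ k) a)))"
    by (simp add: linear_props[OF \<sigma>_linear])
  also have "\<dots> = (\<Sum>k<l. sV (?t ^ k / fact k) (sV ?c ((\<N> ^^ k) a)))"
    using eigen_\<N>_pow[OF a] m by (simp add: eigen_component_def)
  finally have \<phi>_a: "(\<sigma> \<circ> exp_op sV ?t \<N>) a = (\<Sum>k<l. sV (?t ^ k / fact k) (sV ?c ((\<N> ^^ k) a)))" .
  have "monodromy sW (Y a v) \<gamma> j = Y ((\<sigma> \<circ> exp_op sV ?t \<N>) a) v \<gamma> j"
    using Y_equivariant unfolding equivariant_def by metis
  also have "\<dots> = sW ?c (\<Sum>k<l. sW (?t ^ k / fact k) (Y ((\<N> ^^ k) a) v \<gamma> j))"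
    unfolding \<phi>_a linear_props(6)[OF Y_linear] linear_props(2)[OF Y_linear] W.scale_sum_right
    by (simp add: mult.commute)
  finally show ?thesis
    by (simp add: monodromy_def)
qed

text \<open>By induction on the nilpotency order only the summand \<open>k = 0\<close> of the equivariance formula survives
  at \<open>z\<^sup>\<gamma>\<close>.  Since \<open>\<zeta> \<mapsto> \<zeta> + 2\<pi>i\<close> preserves the leading coefficient of a nonzero
  polynomial, \<open>e\<^bsup>2\<pi>i\<gamma>\<^esup>\<close> must equal the eigenvalue \<open>e\<^bsup>-2\<pi>im\<^esup>\<close>.\<close>

lemma Y_exponents:
  assumes \<alpha>: "\<alpha> \<in> CmodZ" and a: "a \<in> eigen \<alpha>" and m: "m \<in> \<alpha>" and nonzero: "Y a v \<gamma> k \<noteq> 0"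
  shows "m + \<gamma> \<in> \<int>"
proof (rule ccontr)
  assume not_int: "m + \<gamma> \<notin> \<int>"
  let ?u = "exp (2 * of_real pi * \<i> * \<gamma>)" and ?c = "exp (2 * of_real pi * \<i> * (- m))"
  have neq: "?u \<noteq> ?c"
    using not_int exp_2pi_i_eq_iff[of \<gamma> "- m"] by (simp add: add.commute)
  have "\<forall>k. Y a v \<gamma> k = 0" if "a \<in> eigen \<alpha>" "(\<N> ^^ l) a = 0" for a l
    using that
  proof (induction l arbitrary: a)
    case 0
    then show ?case by simp
  next
    case (Suc l)
    show ?case
    proof (rule ccontr)
      assume "\<not> ?thesis"
      then obtain k where k: "Y a v \<gamma> k \<noteq> 0" by blast
      have "finite {i. Y a v \<gamma> i \<noteq> 0}"
        by (rule W.LFie_finite_log[OF Y_LFie])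
      from finite_nonzero_has_last[of "Y a v \<gamma>", OF this k] obtain d
        where d: "Y a v \<gamma> d \<noteq> 0" and d_last: "\<And>i. i > d \<Longrightarrow> Y a v \<gamma> i = 0" by blast
      have \<N>a: "\<forall>k. Y (\<N> a) v \<gamma> k = 0"
        using Suc by (intro Suc.IH) (simp_all add: eigen_\<N> funpow_swap1)
      have higher: "Y ((\<N> ^^ Suc k) a) v \<gamma> j = 0" for k j
      proof -
        have "(\<N> ^^ l) ((\<N> ^^ Suc k) a) = 0"
          by (rule \<N>_pow_vanishes_above[OF Suc.prems(2)])
        then show ?thesis
          using Suc.IH[of "(\<N> ^^ Suc k) a"] eigen_\<N>_pow[OF Suc.prems(1)] by blast
      qed
      obtain L where L: "\<forall>k\<ge>L. (\<N> ^^ k) a = 0"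
        using \<N>_pow_vanishes by blast
      have "(\<Sum>k<Suc L. sW ((- 2 * of_real pi * \<i>) ^ k / fact k) (Y ((\<N> ^^ k) a) v \<gamma> d))
          = Y a v \<gamma> d"
        by (subst sum.lessThan_Suc_shift) (simp add: higher del: funpow.simps(2))
      moreover have "Sum_any (\<lambda>i. sW (of_nat (i choose d) * (2 * of_real pi * \<i>) ^ (i - d)) (Y a v \<gamma> i))
          = Sum_any (\<lambda>i. if i = d then Y a v \<gamma> d else 0)"
      proof (rule Sum_any.cong)
        fix i
        show "sW (of_nat (i choose d) * (2 * of_real pi * \<i>) ^ (i - d)) (Y a v \<gamma> i)
            = (if i = d then Y a v \<gamma> d else 0)"
          using d_last[of i] by (cases i d rule: linorder_cases) simp_all
      qed
      ultimately have "sW ?u (Y a v \<gamma> d) = sW ?c (Y a v \<gamma> d)"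
        using equivariance_coefficient[OF Suc.prems(1) m, of "Suc L" \<gamma> d v] L
        by (simp only: Sum_any.delta)
      with neq d show False
        by simp
    qed
  qed
  moreover obtain l where "(\<N> ^^ l) a = 0"
    using \<N>_pow_vanishes[of a] by blast
  ultimately show False
    using a nonzero by blast
qed

text \<open>When the exponent is admissible, the exponential factors cancel in the equivariance formula.  By induction
  on the nilpotency order the claim may be used for \<open>\<N>\<^sup>ka\<close> with \<open>k \<ge> 1\<close>; the formula
  then says that a polynomial measuring the failure of the claim for \<open>a\<close> is invariant under
  \<open>\<zeta> \<mapsto> \<zeta> + 2\<pi>i\<close>.  Such a polynomial is constant, and the constant term satisfies the claim
  trivially.\<close>

lemma Y_log_coefficient_eigen:
  assumes \<alpha>: "\<alpha> \<in> CmodZ" and a: "a \<in> eigen \<alpha>"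
  shows "Y a v \<gamma> k = sW ((-1) ^ k / fact k) (Y ((\<N> ^^ k) a) v \<gamma> 0)"
proof -
  obtain m where m: "m \<in> \<alpha>"
    using CmodZ_nonempty[OF \<alpha>] by blast
  show ?thesis
  proof (cases "m + \<gamma> \<in> \<int>")
    case False
    then show ?thesis
      using Y_exponents[OF \<alpha> a m] Y_exponents[OF \<alpha> eigen_\<N>_pow[OF a] m] by (metis W.scale_zero_right)
  next
    case True
    let ?t = "- 2 * of_real pi * \<i>"
    have eq_exp: "exp (2 * of_real pi * \<i> * \<gamma>) = exp (2 * of_real pi * \<i> * (- m))"
      using True exp_2pi_i_eq_iff[of \<gamma> "- m"] by (simp add: add.commute)
    have "\<forall>k. Y a v \<gamma> k = sW ((-1) ^ k / fact k) (Y ((\<N> ^^ k) a) v \<gamma> 0)"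
      if "a \<in> eigen \<alpha>" "(\<N> ^^ l) a = 0" for a l
      using that
    proof (induction l arbitrary: a)
      case 0
      then show ?case by (simp add: linear_props(3)[OF \<N>_pow_linear])
    next
      case (Suc l)
      \<comment> \<open>The failure of the claim at \<open>i\<close>, with denominators cleared.\<close>
      define e where "e i = sW (fact i) (Y a v \<gamma> i) - sW ((-1) ^ i) (Y ((\<N> ^^ i) a) v \<gamma> 0)" for i
      have e0: "e 0 = 0" by (simp add: e_def)
      obtain L where L: "\<And>k. k \<ge> L \<Longrightarrow> (\<N> ^^ k) a = 0"
        using \<N>_pow_vanishes by blast
      obtain L' where L': "\<And>k. k \<ge> L' \<Longrightarrow> Y a v \<gamma> k = 0"
        using W.LFie_finite_log[OF Y_LFie, of a v \<gamma>]
        by (metis (mono_tags, lifting) finite_nat_set_iff_bounded linorder_not_le mem_Collect_eq)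
      have higher: "Y ((\<N> ^^ Suc k) a) v \<gamma> j
          = sW ((-1) ^ j / fact j) (Y ((\<N> ^^ (j + Suc k)) a) v \<gamma> 0)" for k j
      proof -
        have "(\<N> ^^ l) ((\<N> ^^ Suc k) a) = 0"
          by (rule \<N>_pow_vanishes_above[OF Suc.prems(2)])
        then have "Y ((\<N> ^^ Suc k) a) v \<gamma> j
            = sW ((-1) ^ j / fact j) (Y ((\<N> ^^ j) ((\<N> ^^ Suc k) a)) v \<gamma> 0)"
          using Suc.IH[of "(\<N> ^^ Suc k) a"] eigen_\<N>_pow[OF Suc.prems(1)] by blast
        then show ?thesis
          by (simp only: funpow_add comp_apply)
      qed
      have "e i = 0" for i
      proof (rule ccontr)
        assume i: "e i \<noteq> 0"
        have "{i. e i \<noteq> 0} \<subseteq> {..<max L L'}"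
        proof
          fix i assume "i \<in> {i. e i \<noteq> 0}"
          then have "i < L \<or> i < L'"
            using L[of i] L'[of i] unfolding e_def by (force simp: not_less)
          then show "i \<in> {..<max L L'}" by auto
        qed
        then have fin: "finite {i. e i \<noteq> 0}"
          by (rule finite_subset) simp
        from finite_nonzero_has_last[of e, OF fin i] obtain d
          where d: "e d \<noteq> 0" and d_last: "\<And>i. i > d \<Longrightarrow> e i = 0" by blast
        \<comment> \<open>Let \<open>d\<close> be the degree.  Comparing coefficients one degree lower isolates \<open>e d\<close>.\<close>
        obtain j where j: "d = Suc j"
          using d e0 by (cases d) auto
        define K where "K = Suc (Suc (max L L'))"
        have "Sum_any (\<lambda>i. sW (of_nat (i choose j) * (2 * of_real pi * \<i>) ^ (i - j)) (Y a v \<gamma> i))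
            = Sum_any (\<lambda>k. sW (of_nat ((k + j) choose j) * (- ?t) ^ k) (Y a v \<gamma> (k + j)))"
        proof (subst Sum_any_reindex[of "\<lambda>k. k + j"])
          show "inj (\<lambda>k. k + j)" by (simp add: inj_def)
          fix i assume "sW (of_nat (i choose j) * (2 * of_real pi * \<i>) ^ (i - j)) (Y a v \<gamma> i) \<noteq> 0"
          then have "j \<le> i"
            by (cases "j \<le> i") (simp_all add: binomial_eq_0)
          then show "i \<in> range (\<lambda>k. k + j)"
            by (metis le_add_diff_inverse2 rangeI)
        qed simp
        also have "\<dots> = (\<Sum>k<K. sW (of_nat ((k + j) choose j) * (- ?t) ^ k) (Y a v \<gamma> (k + j)))"
          by (rule Sum_any_lessThan) (simp add: L' K_def)
        finally have "(\<Sum>k<K. sW (of_nat ((k + j) choose j) * (- ?t) ^ k) (Y a v \<gamma> (k + j)))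
            = (\<Sum>k<K. sW (?t ^ k / fact k) (Y ((\<N> ^^ k) a) v \<gamma> j))"
          using equivariance_coefficient[OF Suc.prems(1) m, of K \<gamma> j v] L
          by (simp add: eq_exp K_def)
        then have "0 = (\<Sum>k<K. sW (of_nat ((k + j) choose j) * (- ?t) ^ k) (Y a v \<gamma> (k + j))
            - sW (?t ^ k / fact k) (Y ((\<N> ^^ k) a) v \<gamma> j))"
          by (simp add: sum_subtractf)
        also have "\<dots> = (\<Sum>k<K. if k = 1 then sW ((- ?t) / fact j) (e d) else 0)"
        proof (rule sum.cong[OF refl])
          fix k
          show "sW (of_nat ((k + j) choose j) * (- ?t) ^ k) (Y a v \<gamma> (k + j))
              - sW (?t ^ k / fact k) (Y ((\<N> ^^ k) a) v \<gamma> j)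
            = (if k = 1 then sW ((- ?t) / fact j) (e d) else 0)"
          proof (cases k)
            case (Suc k')
            have c1: "(of_nat ((k + j) choose j) :: complex) = fact (k + j) / (fact k * fact j)"
              by (simp add: binomial_fact)
            have c2: "?t ^ k * ((-1) ^ j / fact j) = (- ?t) ^ k * (-1) ^ (j + k) / fact j"
              by (rule power_sign_shift)
            have "sW (of_nat ((k + j) choose j) * (- ?t) ^ k) (Y a v \<gamma> (k + j))
                - sW (?t ^ k / fact k) (Y ((\<N> ^^ k) a) v \<gamma> j)
              = sW ((- ?t) ^ k / (fact k * fact j)) (e (j + k))"
              unfolding Suc higher
              unfolding Suc[symmetric] c1 e_def W.scale_right_diff_distrib W.scale_scale
              using c2 by (simp add: mult_ac add.commute)
            then show ?thesis
              using d_last[of "j + k"] Suc by (auto simp: j)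
          qed simp
        qed
        also have "\<dots> = sW ((- ?t) / fact j) (e d)"
        proof -
          have "1 < K" by (simp add: K_def)
          then show ?thesis by (subst sum.delta) auto
        qed
        finally show False
          using d by simp
      qed
      then have e_zero: "sW (fact i) (Y a v \<gamma> i) = sW ((-1) ^ i) (Y ((\<N> ^^ i) a) v \<gamma> 0)" for i
        by (simp add: e_def)
      show ?case
      proof
        fix i
        have "Y a v \<gamma> i = sW (1 / fact i) (sW (fact i) (Y a v \<gamma> i))"
          by simp
        then show "Y a v \<gamma> i = sW ((-1) ^ i / fact i) (Y ((\<N> ^^ i) a) v \<gamma> 0)"
          unfolding e_zero by simp
      qed
    qed
    moreover obtain l where "(\<N> ^^ l) a = 0"
      using \<N>_pow_vanishes[of a] by blast
    ultimately show ?thesis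
      using a by blast
  qed
qed

lemma Y_log_coefficient: "Y a v \<gamma> k = sW ((-1) ^ k / fact k) (Y ((\<N> ^^ k) a) v \<gamma> 0)"
proof -
  have "a \<in> V.span (\<Union>\<alpha>\<in>CmodZ. eigen \<alpha>)"
    by (simp add: span_eigen)
  then show ?thesis
  proof (induction rule: V.span_induct_alt)
    case base
    show ?case by (simp add: linear_props(3)[OF \<N>_pow_linear])
  next
    case (step c x y)
    then obtain \<alpha> where "\<alpha> \<in> CmodZ" "x \<in> eigen \<alpha>" by blast
    from Y_log_coefficient_eigen[OF this] step(2) show ?case
      by (simp only: linear_props[OF Y_linear] linear_props[OF \<N>_pow_linear] W.scale_right_distrib
          W.scale_scale mult.commute)
  qed
qed


section \<open>The Borcherds identity without logarithms\<close>

lemma delta_linear: "Vector_Spaces.linear sV sV (\<lambda>a. delta sV \<alpha> \<N> a \<gamma>1 k1 \<gamma>2 k2)"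
  unfolding Vector_Spaces.linear_iff
  by (intro conjI allI V.vector_space_axioms)
    (simp_all add: delta_def linear_props[OF \<N>_pow_linear] V.scale_right_distrib mult.commute)

text \<open>In the second variables \<open>\<delta>\<^bsub>\<alpha>+\<N>\<^esup>\<close> depends on \<open>\<zeta>\<^sub>2\<close> through \<open>e\<^bsup>\<zeta>\<^sub>2\<N>\<^esup>a\<close>, so \<open>\<partial>\<^sub>\<zeta>\<close> acts as \<open>\<N>\<close>.\<close>

lemma divided_power_delta:
  "divided_power sV (D_z2 sV) i (delta sV \<alpha> \<N> a) \<gamma>1 k1 \<gamma>2 k2
    = delta sV \<alpha> \<N> (op_choose sV (\<lambda>x. sV (\<gamma>2 + of_nat i) x + \<N> x) i a) \<gamma>1 k1 (\<gamma>2 + of_nat i) k2"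
  unfolding divided_power_def D_z2_funpow
proof (rule V.D_log_funpow_family[where H = "\<lambda>a. delta sV \<alpha> \<N> a \<gamma>1 k1"])
  show "Vector_Spaces.linear sV sV (\<lambda>a. delta sV \<alpha> \<N> a \<gamma>1 k1 \<gamma> k)" for \<gamma> k
    by (rule delta_linear)
  show "sV (of_nat (Suc k)) (delta sV \<alpha> \<N> a \<gamma>1 k1 \<gamma> (Suc k)) = delta sV \<alpha> \<N> (\<N> a) \<gamma>1 k1 \<gamma> k" for a \<gamma> k
    by (simp add: delta_def funpow_swap1 del: of_nat_Suc)
qed

lemma shifted_\<N>_linear:
  "Vector_Spaces.linear sV sV (\<lambda>x. sV m x + \<N> x)" "Vector_Spaces.linear sV sV (\<lambda>x. sV m x - \<N> x)"
  unfolding Vector_Spaces.linear_iff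
  by (simp_all add: V.vector_space_axioms linear_props[OF \<N>_linear] V.scale_right_distrib
      V.scale_right_diff_distrib mult.commute)

abbreviation \<N>_choose :: "complex \<Rightarrow> nat \<Rightarrow> 'v \<Rightarrow> 'v" where
  "\<N>_choose m \<equiv> op_choose sV (\<lambda>x. sV m x + \<N> x)"

abbreviation \<N>_choose' :: "complex \<Rightarrow> nat \<Rightarrow> 'v \<Rightarrow> 'v" where
  "\<N>_choose' m \<equiv> op_choose sV (\<lambda>x. sV m x - \<N> x)"

text \<open>Powers of \<open>\<N>\<close> are included to make this set stable under \<open>\<N>\<close>, hence under the operators
  \<open>(m+\<N>) choose i\<close> that occur in the Borcherds identity.\<close>

definition annihilated :: "nat \<Rightarrow> 'v \<Rightarrow> 'v set" where
  "annihilated M b = {a. \<forall>k. \<forall>n\<ge>int M. pr ((\<N> ^^ k) a) n b = 0}"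

lemma annihilated_subspace: "V.subspace (annihilated M b)"
  by (rule V.subspaceI)
    (simp_all add: annihilated_def linear_props[OF \<N>_pow_linear] linear_props[OF pr_linear(1)])

lemma annihilated_\<N>: "a \<in> annihilated M b \<Longrightarrow> \<N> a \<in> annihilated M b"
  using funpow_Suc_right[of _ \<N>, THEN fun_cong, of _ a] by (simp add: annihilated_def del: funpow.simps) metis

lemma annihilatedD: "a \<in> annihilated M b \<Longrightarrow> n \<ge> int M \<Longrightarrow> pr ((\<N> ^^ k) a) n b = 0"
  by (simp add: annihilated_def)

lemma annihilated_pr: "a \<in> annihilated M b \<Longrightarrow> n \<ge> int M \<Longrightarrow> pr a n b = 0"
  using annihilatedD[of a M b n 0] by simp

lemma \<N>_choose_in:
  assumes "V.subspace U" and "\<And>x. x \<in> U \<Longrightarrow> \<N> x \<in> U" and "a \<in> U"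
  shows "\<N>_choose m i a \<in> U"
  using assms by (intro V.op_choose_in_subspace[where U = U]) (auto intro: V.subspace_add V.subspace_scale)

text \<open>Fixing the exponent \<open>-m-1\<close> of \<open>z\<^sub>1\<close> selects a single term of each derivative of
  \<open>\<delta>\<^bsub>\<alpha>+\<N>\<^esup>\<close>.\<close>

lemma borcherds_at_zero_logs:
  assumes \<alpha>: "\<alpha> \<in> CmodZ" and a: "a \<in> eigen \<alpha>" and m: "m \<in> \<alpha>"
  shows "mult_iota12 sW n (comp12 (Y a) (Y b) v) (- m - 1) 0 (m + \<gamma>) 0
      - mult_iota21 sW n (comp21 (Y b) (Y a) v) (- m - 1) 0 (m + \<gamma>) 0
    = Sum_any (\<lambda>i. Y (pr (\<N>_choose m i a) (n + int i) b) v (\<gamma> + of_nat i) 0)"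
proof -
  have coeff: "Y_ext Y (\<lambda>\<gamma>1 k1 \<gamma>2 k2.
      pr (divided_power sV (D_z2 sV) i (delta sV \<alpha> \<N> a) \<gamma>1 k1 \<gamma>2 k2) (n + int i) b) v
      (- m - 1) 0 (m + \<gamma>) 0
    = Y (pr (\<N>_choose m i a) (n + int i) b) v (\<gamma> + of_nat i) 0" (is "?lhs = ?rhs") for i
  proof -
    have "?lhs = Sum_any (\<lambda>x. if x = m - of_nat i then ?rhs else 0)"
      unfolding Y_ext_def divided_power_delta
    proof (rule Sum_any.cong)
      fix x
      show "(\<Sum>k\<le>0. Y (pr (delta sV \<alpha> \<N> (\<N>_choose (x + of_nat i) i a) (- m - 1) 0 (x + of_nat i) k)
          (n + int i) b) v (m + \<gamma> - x) (0 - k)) = (if x = m - of_nat i then ?rhs else 0)"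
      proof (cases "x = m - of_nat i")
        case True
        then show ?thesis
          using m by (simp add: delta_def)
      next
        case False
        then have "m \<noteq> x + of_nat i"
          by auto
        with False show ?thesis
          by (simp add: delta_def linear_props(3)[OF pr_linear(1)])
      qed
    qed
    then show ?thesis
      by (simp only: Sum_any.delta)
  qed
  show ?thesis
    using Y_borcherds[unfolded twisted_borcherds_def, rule_format, OF \<alpha> a, of n b v "- m - 1" 0 "m + \<gamma>" 0]
    unfolding coeff .
qed

lemma local_of_order_annihilated:
  assumes \<alpha>: "\<alpha> \<in> CmodZ" and a: "a \<in> eigen \<alpha>" and annihilated: "a \<in> annihilated M b"
  shows "local_of_order M (Y a) (Y b)"
  unfolding local_of_order_def
proof
  fix v
  have zero: "pr (divided_power sV (D_z2 sV) i (delta sV \<alpha> \<N> a) \<gamma>1 k1 \<gamma>2 k2) (int M + int i) b = 0"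
    for i \<gamma>1 k1 \<gamma>2 k2
  proof -
    have "\<N>_choose (\<gamma>2 + of_nat i) i a \<in> annihilated M b"
      by (rule \<N>_choose_in[OF annihilated_subspace annihilated_\<N> annihilated])
    then show ?thesis
      unfolding divided_power_delta
      by (simp add: delta_def linear_props[OF pr_linear(1)] annihilatedD)
  qed
  have "mult_iota12 sW (int M) (comp12 (Y a) (Y b) v) = mult_iota21 sW (int M) (comp21 (Y b) (Y a) v)"
  proof (intro ext)
    fix \<gamma>1 k1 \<gamma>2 k2
    show "mult_iota12 sW (int M) (comp12 (Y a) (Y b) v) \<gamma>1 k1 \<gamma>2 k2
      = mult_iota21 sW (int M) (comp21 (Y b) (Y a) v) \<gamma>1 k1 \<gamma>2 k2"
      using Y_borcherds[unfolded twisted_borcherds_def, rule_format, OF \<alpha> a, of "int M" b v \<gamma>1 k1 \<gamma>2 k2]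
      unfolding zero by (simp add: Y_ext_def)
  qed
  then show "(mult_z12 ^^ M) (comp12 (Y a) (Y b) v) = (mult_z12 ^^ M) (comp21 (Y b) (Y a) v)"
    using W.mult_iota12_funpow_mult_z12[OF W.lower_bounded2_comp12[OF Y_LFie Y_LFie], of "int M" a b v M]
      W.mult_iota21_funpow_mult_z12[OF W.lower_bounded1_comp21[OF Y_LFie Y_LFie], of "int M" b a v M]
    by simp
qed


section \<open>Taylor expansion of the regularized product\<close>

definition regular :: "nat \<Rightarrow> 'v \<Rightarrow> 'v \<Rightarrow> 'w \<Rightarrow> 'w ser2" where
  "regular M a b v = (mult_z12 ^^ M) (comp12 (Y a) (Y b) v)"

lemma regular_Suc:
  "regular (Suc M) a b v \<gamma>1 k1 \<gamma>2 k2
    = regular M a b v (\<gamma>1 - 1) k1 \<gamma>2 k2 - regular M a b v \<gamma>1 k1 (\<gamma>2 - 1) k2"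
  by (simp add: regular_def mult_z12_def)

lemma regular_0: "regular 0 a b v \<gamma>1 k1 \<gamma>2 k2 = Y a (Y b v \<gamma>2 k2) \<gamma>1 k1"
  by (simp add: regular_def comp12_def)

lemma regular_linear: "Vector_Spaces.linear sV sW (\<lambda>a. regular M a b v \<gamma>1 k1 \<gamma>2 k2)"
proof (induction M arbitrary: \<gamma>1 \<gamma>2)
  case 0
  show ?case unfolding regular_0 by (rule Y_linear)
next
  case (Suc M)
  show ?case
    unfolding regular_Suc Vector_Spaces.linear_iff
    by (simp add: V.vector_space_axioms W.vector_space_axioms linear_props[OF Suc]
        W.scale_right_diff_distrib)
qed

text \<open>On the regularized product, \<open>\<partial>\<^sub>\<zeta>\<close> in the first variables acts as \<open>-\<N>\<close> on \<open>a\<close>; the powers of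
  \<open>z\<^sub>1\<^sub>2\<close> contain no logarithms.\<close>

lemma regular_log1:
  "sW (of_nat (Suc k1)) (regular M a b v \<gamma>1 (Suc k1) \<gamma>2 k2) = regular M (- \<N> a) b v \<gamma>1 k1 \<gamma>2 k2"
proof (induction M arbitrary: \<gamma>1 \<gamma>2)
  case 0
  have "sW (of_nat (Suc k1)) (Y a w \<gamma>1 (Suc k1)) = Y (- \<N> a) w \<gamma>1 k1" for w
    unfolding linear_props(5)[OF Y_linear] Y_log_coefficient[of a w \<gamma>1 "Suc k1"]
      Y_log_coefficient[of "\<N> a" w \<gamma>1 k1]
    by (simp add: funpow_swap1 del: of_nat_Suc)
  then show ?case unfolding regular_0 .
next
  case (Suc M)
  show ?case
    unfolding regular_Suc W.scale_right_diff_distrib Suc ..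
qed

lemma regular_logs:
  "regular M a b v \<gamma>1 k1 \<gamma>2 k2 = sW ((-1) ^ (k1 + k2) / (fact k1 * fact k2))
     (regular M ((\<N> ^^ k1) a) ((\<N> ^^ k2) b) v \<gamma>1 0 \<gamma>2 0)"
proof (induction M arbitrary: \<gamma>1 \<gamma>2)
  case 0
  show ?case
    unfolding regular_0 Y_log_coefficient[of a _ \<gamma>1 k1] Y_log_coefficient[of b v \<gamma>2 k2]
      linear_props(2)[OF Y_linear_arg] W.scale_scale
    by (simp add: power_add mult.commute)
next
  case (Suc M)
  show ?case
    unfolding regular_Suc W.scale_right_diff_distrib Suc[symmetric] ..
qed

lemma regular_exponents:
  assumes \<alpha>: "\<alpha> \<in> CmodZ" and a: "a \<in> eigen \<alpha>" and m: "m \<in> \<alpha>" and nonzero: "regular M a b v \<gamma>1 k1 \<gamma>2 k2 \<noteq> 0"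
  shows "m + \<gamma>1 \<in> \<int>"
proof -
  obtain i where "comp12 (Y a) (Y b) v (\<gamma>1 - of_nat i) k1 (\<gamma>2 - of_nat (M - i)) k2 \<noteq> 0"
    using mult_z12_funpow_support[OF nonzero[unfolded regular_def]] by blast
  then have "m + (\<gamma>1 - of_nat i) \<in> \<int>"
    unfolding comp12_def by (rule Y_exponents[OF \<alpha> a m])
  then have "(m + (\<gamma>1 - of_nat i)) + of_nat i \<in> \<int>"
    by (rule Ints_add) simp
  then show ?thesis by simp
qed

definition regular_deriv :: "nat \<Rightarrow> nat \<Rightarrow> 'v \<Rightarrow> 'v \<Rightarrow> 'w \<Rightarrow> 'w ser2" where
  "regular_deriv M j a b v = divided_power sW (D_z1 sW) j (regular M a b v)"

lemma regular_deriv_eq_regular: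
  "regular_deriv M j a b v \<gamma>1 k1 \<gamma>2 k2 = regular M (\<N>_choose' (\<gamma>1 + of_nat j) j a) b v (\<gamma>1 + of_nat j) k1 \<gamma>2 k2"
proof -
  have "sW (1 / fact j) ((D_log sW ^^ j) (\<lambda>\<gamma> k. regular M a b v \<gamma> k \<gamma>2 k2) \<gamma>1 k1)
    = regular M (op_choose sV (\<lambda>a. sV (\<gamma>1 + of_nat j) a + - \<N> a) j a) b v (\<gamma>1 + of_nat j) k1 \<gamma>2 k2"
    by (rule V.D_log_funpow_family[where H = "\<lambda>a \<gamma> k. regular M a b v \<gamma> k \<gamma>2 k2"])
      (rule regular_linear regular_log1)+
  then show ?thesis
    by (simp add: regular_deriv_def divided_power_def D_z1_funpow)
qed

text \<open>By \<open>regular_deriv_eq_regular\<close> the divided powers of \<open>D\<close> act at \<open>z\<^sub>1\<^sup>r\<close> as binomial coefficients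
  of \<open>r - \<N>\<close>.  Together with those of \<open>m + \<N>\<close> they add up by Vandermonde's identity.\<close>

lemma Taylor_expansion:
  "sW ((m + r) gchoose j) (regular M a b v r k1 \<gamma>2 k2)
    = (\<Sum>i\<le>j. regular_deriv M (j - i) (\<N>_choose m i a) b v (r - of_nat (j - i)) k1 \<gamma>2 k2)"
proof -
  have "(\<Sum>i\<le>j. \<N>_choose' r (j - i) (\<N>_choose m i a))
      = (\<Sum>i\<le>j. \<N>_choose' r i (\<N>_choose m (j - i) a))"
    by (rule sum.reindex_bij_witness[of _ "\<lambda>i. j - i" "\<lambda>i. j - i"]) auto
  also have "\<dots> = sV ((m + r) gchoose j) a"
    by (rule V.op_choose_Vandermonde[OF shifted_\<N>_linear(2) shifted_\<N>_linear(1)])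
      (simp add: V.scale_left_distrib)
  finally have "sV ((m + r) gchoose j) a = (\<Sum>i\<le>j. \<N>_choose' r (j - i) (\<N>_choose m i a))" ..
  then have "sW ((m + r) gchoose j) (regular M a b v r k1 \<gamma>2 k2)
      = (\<Sum>i\<le>j. regular M (\<N>_choose' r (j - i) (\<N>_choose m i a)) b v r k1 \<gamma>2 k2)"
    by (simp flip: linear_props(2)[OF regular_linear] add: linear_props(6)[OF regular_linear])
  then show ?thesis
    by (simp add: regular_deriv_eq_regular)
qed

lemma regular_deriv_antidiag_finite:
  assumes "local_of_order M (Y a) (Y b)"
  shows "antidiag_finite (regular_deriv M j a b v)"
  unfolding regular_deriv_def regular_def
  by (intro W.antidiag_finite_divided_power W.antidiag_finite_local Y_LFie assms)

lemma diagonal_zero: "diagonal H \<gamma> 0 = Sum_any (\<lambda>x. H x 0 (\<gamma> - x) 0)"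
  by (simp add: diagonal_def)

text \<open>The left-hand side of lemma \<open>borcherds_at_zero_logs\<close>, with \<open>z\<^sub>1\<^sub>2\<^sup>M\<close> moved from the power
  of \<open>z\<^sub>1\<^sub>2\<close> into the fields.  The exponents of \<open>z\<^sub>1\<close> lie in \<open>-m + \<int>\<close>, so the sum over integers \<open>p\<close>
  is a sum over all exponents \<open>r = p - m\<close>.\<close>

lemma iota_difference_regular:
  assumes \<alpha>: "\<alpha> \<in> CmodZ" and a: "a \<in> eigen \<alpha>" and m: "m \<in> \<alpha>" and loc: "local_of_order M (Y a) (Y b)"
  shows "mult_iota12 sW (int M - 1 - int j) (comp12 (Y a) (Y b) v) (- m - 1) 0 (m + \<gamma>) 0
      - mult_iota21 sW (int M - 1 - int j) (comp21 (Y b) (Y a) v) (- m - 1) 0 (m + \<gamma>) 0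
    = Sum_any (\<lambda>r. sW ((m + r) gchoose j) (regular M a b v r 0 (\<gamma> + of_nat j - r) 0))"
proof -
  define h where "h p = of_int p - m" for p :: int
  have inj: "inj h" by (simp add: h_def inj_def)
  have n: "int M - 1 - int j - int M = - int j - 1" by simp
  have F21: "(mult_z12 ^^ M) (comp21 (Y b) (Y a) v) = regular M a b v"
    using loc by (simp add: local_of_order_def regular_def)
  have shift: "regular M a b v (- m - 1 + 1 + of_int p) 0 (m + \<gamma> + of_nat j - of_int p) 0
      = regular M a b v (h p) 0 (\<gamma> + of_nat j - h p) 0" for p
    by (simp add: h_def algebra_simps)
  have "finite {r. regular M a b v r 0 (\<gamma> + of_nat j - r) 0 \<noteq> 0}"
    unfolding regular_def by (intro antidiag_finite_term W.antidiag_finite_local Y_LFie loc)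
  then have fin: "finite {p. regular M a b v (- m - 1 + 1 + of_int p) 0 (m + \<gamma> + of_nat j - of_int p) 0 \<noteq> 0}"
    unfolding shift using finite_vimageI[OF _ inj] by (force simp: vimage_def)
  have "mult_iota12 sW (int M - 1 - int j) (comp12 (Y a) (Y b) v) (- m - 1) 0 (m + \<gamma>) 0
      - mult_iota21 sW (int M - 1 - int j) (comp21 (Y b) (Y a) v) (- m - 1) 0 (m + \<gamma>) 0
    = mult_iota12 sW (- int j - 1) (regular M a b v) (- m - 1) 0 (m + \<gamma>) 0
      - mult_iota21 sW (- int j - 1) (regular M a b v) (- m - 1) 0 (m + \<gamma>) 0"
    unfolding
      W.mult_iota12_funpow_mult_z12[OF W.lower_bounded2_comp12[OF Y_LFie Y_LFie], of "int M - 1 - int j" a b v M]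
      W.mult_iota21_funpow_mult_z12[OF W.lower_bounded1_comp21[OF Y_LFie Y_LFie], of "int M - 1 - int j" b a v M]
      n F21 regular_def[symmetric] ..
  also have "\<dots> = Sum_any (\<lambda>p. sW (of_int p gchoose j) (regular M a b v (h p) 0 (\<gamma> + of_nat j - h p) 0))"
    using W.iota_difference[of "regular M a b v" "- m - 1" 0 "m + \<gamma>" j 0, OF fin] unfolding shift .
  also have "\<dots> = Sum_any (\<lambda>p. sW ((m + h p) gchoose j) (regular M a b v (h p) 0 (\<gamma> + of_nat j - h p) 0))"
    by (simp add: h_def)
  also have "\<dots> = Sum_any (\<lambda>r. sW ((m + r) gchoose j) (regular M a b v r 0 (\<gamma> + of_nat j - r) 0))"
  proof (rule Sum_any_reindex[OF inj, symmetric])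
    fix r assume "sW ((m + r) gchoose j) (regular M a b v r 0 (\<gamma> + of_nat j - r) 0) \<noteq> 0"
    then have "regular M a b v r 0 (\<gamma> + of_nat j - r) 0 \<noteq> 0"
      by auto
    from regular_exponents[OF \<alpha> a m this] obtain p where "m + r = of_int p"
      by (auto elim: Ints_cases)
    then have "r = h p"
      by (simp add: h_def algebra_simps)
    then show "r \<in> range h" by blast
  qed
  finally show ?thesis .
qed

text \<open>The Borcherds identity is triangular in \<open>j\<close>: the Taylor expansion writes its left-hand side as a
  sum over \<open>i \<le> j\<close> of the left-hand sides of the claim for \<open>j - i\<close> and \<open>(m+\<N>) choose i\<close> applied
  to \<open>a\<close>, and its right-hand side is the corresponding sum of right-hand sides.\<close>

lemma diagonal_regular_deriv_zero_log:
  assumes \<alpha>: "\<alpha> \<in> CmodZ" and "a \<in> eigen \<alpha>" and "a \<in> annihilated M b"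
  shows "diagonal (regular_deriv M j a b v) \<gamma> 0 = Y (pr a (int M - 1 - int j) b) v \<gamma> 0"
  using assms(2,3)
proof (induction j arbitrary: a \<gamma> rule: less_induct)
  case (less j)
  obtain m where m: "m \<in> \<alpha>"
    using CmodZ_nonempty[OF \<alpha>] by blast
  let ?n = "int M - 1 - int j"
  let ?x = "\<lambda>i. \<N>_choose m i a"
  have x_eigen: "?x i \<in> eigen \<alpha>" for i
    by (rule \<N>_choose_in[OF eigen_subspace eigen_\<N> less.prems(1)])
  have x_annihilated: "?x i \<in> annihilated M b" for i
    by (rule \<N>_choose_in[OF annihilated_subspace annihilated_\<N> less.prems(2)])
  have x_finite: "antidiag_finite (regular_deriv M k (?x i) b v)" for i k
    by (rule regular_deriv_antidiag_finite[OF local_of_order_annihilated[OF \<alpha> x_eigen x_annihilated]])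
  have shift: "Sum_any (\<lambda>r. regular_deriv M (j - i) (?x i) b v (r - of_nat (j - i)) 0 (\<gamma> + of_nat j - r) 0)
      = diagonal (regular_deriv M (j - i) (?x i) b v) (\<gamma> + of_nat i) 0" if "i \<le> j" for i
  proof -
    have "Sum_any (\<lambda>r. regular_deriv M (j - i) (?x i) b v (r - of_nat (j - i)) 0 (\<gamma> + of_nat j - r) 0)
        = Sum_any (\<lambda>x. regular_deriv M (j - i) (?x i) b v (x + of_nat (j - i) - of_nat (j - i)) 0
            (\<gamma> + of_nat j - (x + of_nat (j - i))) 0)"
    proof (rule Sum_any_reindex)
      show "inj (\<lambda>x. x + of_nat (j - i) :: complex)" by (simp add: inj_def)
      show "r \<in> range (\<lambda>x. x + of_nat (j - i))" for r :: complex
        by (metis diff_add_cancel rangeI)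
    qed
    also have "\<dots> = diagonal (regular_deriv M (j - i) (?x i) b v) (\<gamma> + of_nat i) 0"
      unfolding diagonal_zero using that by (intro Sum_any.cong) (simp add: of_nat_diff algebra_simps)
    finally show ?thesis .
  qed
  have fin: "finite {r. regular_deriv M (j - i) (?x i) b v (r - of_nat (j - i)) 0 (\<gamma> + of_nat j - r) 0 \<noteq> 0}"
    if "i \<le> j" for i
  proof -
    have "finite {x. regular_deriv M (j - i) (?x i) b v x 0 (\<gamma> + of_nat i - x) 0 \<noteq> 0}"
      by (rule antidiag_finite_term[OF x_finite])
    then have "finite ((\<lambda>r. r - of_nat (j - i)) -` {x. regular_deriv M (j - i) (?x i) b v x 0 (\<gamma> + of_nat i - x) 0 \<noteq> 0})"
      by (rule finite_vimageI) (simp add: inj_def)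
    moreover have "\<gamma> + of_nat i - (r - of_nat (j - i)) = \<gamma> + of_nat j - r" for r
      using that by (simp add: of_nat_diff)
    ultimately show ?thesis
      by (simp add: vimage_def)
  qed
  have loc: "local_of_order M (Y a) (Y b)"
    by (rule local_of_order_annihilated[OF \<alpha> less.prems])
  \<comment> \<open>Terms with \<open>i > j\<close> have \<open>n + i \<ge> M\<close> and vanish by the choice of \<open>M\<close>.\<close>
  have "(\<Sum>i\<le>j. diagonal (regular_deriv M (j - i) (?x i) b v) (\<gamma> + of_nat i) 0)
      = Sum_any (\<lambda>r. \<Sum>i\<le>j. regular_deriv M (j - i) (?x i) b v (r - of_nat (j - i)) 0 (\<gamma> + of_nat j - r) 0)"
    by (subst Sum_any_sum) (simp_all add: fin shift del: of_nat_diff)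
  also have "\<dots> = Sum_any (\<lambda>r. sW ((m + r) gchoose j) (regular M a b v r 0 (\<gamma> + of_nat j - r) 0))"
    by (simp only: Taylor_expansion)
  also have "\<dots> = Sum_any (\<lambda>i. Y (pr (?x i) (?n + int i) b) v (\<gamma> + of_nat i) 0)"
    unfolding iota_difference_regular[OF \<alpha> less.prems(1) m loc, symmetric]
    by (rule borcherds_at_zero_logs[OF \<alpha> less.prems(1) m])
  also have "\<dots> = (\<Sum>i<Suc j. Y (pr (?x i) (?n + int i) b) v (\<gamma> + of_nat i) 0)"
    by (rule Sum_any_lessThan) (simp add: annihilated_pr[OF x_annihilated])
  finally have sums: "(\<Sum>i\<le>j. diagonal (regular_deriv M (j - i) (?x i) b v) (\<gamma> + of_nat i) 0)
      = (\<Sum>i\<le>j. Y (pr (?x i) (?n + int i) b) v (\<gamma> + of_nat i) 0)"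
    by (simp add: lessThan_Suc_atMost)
  have IH: "diagonal (regular_deriv M (j - i) (?x i) b v) (\<gamma> + of_nat i) 0
      = Y (pr (?x i) (?n + int i) b) v (\<gamma> + of_nat i) 0" if "i \<in> {..j} - {0}" for i
  proof -
    have "int M - 1 - int (j - i) = ?n + int i" and "j - i < j"
      using that by auto
    then show ?thesis
      using less.IH[OF _ x_eigen x_annihilated] by metis
  qed
  have "diagonal (regular_deriv M j a b v) \<gamma> 0 + (\<Sum>i\<in>{..j} - {0}. diagonal (regular_deriv M (j - i) (?x i) b v) (\<gamma> + of_nat i) 0)
      = Y (pr a ?n b) v \<gamma> 0 + (\<Sum>i\<in>{..j} - {0}. Y (pr (?x i) (?n + int i) b) v (\<gamma> + of_nat i) 0)"
    using sums by (simp add: sum.remove[of "{..j}" 0])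
  moreover have "(\<Sum>i\<in>{..j} - {0}. diagonal (regular_deriv M (j - i) (?x i) b v) (\<gamma> + of_nat i) 0)
      = (\<Sum>i\<in>{..j} - {0}. Y (pr (?x i) (?n + int i) b) v (\<gamma> + of_nat i) 0)"
    by (rule sum.cong[OF refl IH])
  ultimately show ?case
    by (simp only: add_right_cancel)
qed


section \<open>Products of arbitrary vectors\<close>

lemma Leibniz:
  "(\<N> ^^ k) (pr a n b) = (\<Sum>i\<le>k. sV (of_nat (k choose i)) (pr ((\<N> ^^ i) a) n ((\<N> ^^ (k - i)) b)))"
proof (induction k)
  case 0
  show ?case by simp
next
  case (Suc k)
  let ?p = "\<lambda>i j. pr ((\<N> ^^ i) a) n ((\<N> ^^ j) b)"
  let ?c = "\<lambda>k i. (of_nat (k choose i) :: complex)"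
  have "(\<N> ^^ Suc k) (pr a n b) = (\<Sum>i\<le>k. sV (?c k i) (?p (Suc i) (k - i)))
      + (\<Sum>i\<le>k. sV (?c k i) (?p i (Suc (k - i))))"
    by (simp add: Suc linear_props[OF \<N>_linear] \<N>_derivation V.scale_right_distrib sum.distrib)
  also have "(\<Sum>i\<le>k. sV (?c k i) (?p i (Suc (k - i)))) = (\<Sum>i\<le>Suc k. sV (?c k i) (?p i (Suc k - i)))"
  proof -
    have "(\<Sum>i\<le>k. sV (?c k i) (?p i (Suc (k - i)))) = (\<Sum>i\<le>k. sV (?c k i) (?p i (Suc k - i)))"
      by (rule sum.cong) (simp_all add: Suc_diff_le)
    then show ?thesis by (simp add: binomial_eq_0)
  qed
  also have "\<dots> = ?p 0 (Suc k) + (\<Sum>i\<le>k. sV (?c k (Suc i)) (?p (Suc i) (k - i)))"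
    by (subst sum.atMost_Suc_shift) simp
  also have "(\<Sum>i\<le>k. sV (?c k i) (?p (Suc i) (k - i)))
        + (?p 0 (Suc k) + (\<Sum>i\<le>k. sV (?c k (Suc i)) (?p (Suc i) (k - i))))
      = ?p 0 (Suc k) + (\<Sum>i\<le>k. sV (?c (Suc k) (Suc i)) (?p (Suc i) (k - i)))"
    by (simp add: V.scale_left_distrib sum.distrib add_ac)
  also have "\<dots> = (\<Sum>i\<le>Suc k. sV (?c (Suc k) i) (?p i (Suc k - i)))"
    by (subst sum.atMost_Suc_shift) simp
  finally show ?case .
qed

lemma regular_deriv_logs:
  "regular_deriv M j a b v \<gamma>1 k1 \<gamma>2 k2 = sW ((-1) ^ (k1 + k2) / (fact k1 * fact k2))
     (regular_deriv M j ((\<N> ^^ k1) a) ((\<N> ^^ k2) b) v \<gamma>1 0 \<gamma>2 0)"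
proof -
  have "(\<N> ^^ k1) (\<N>_choose' x j a) = \<N>_choose' x j ((\<N> ^^ k1) a)" for x
    by (rule V.op_choose_commute[OF \<N>_pow_linear])
      (simp add: linear_props[OF \<N>_pow_linear] funpow_swap1)
  then show ?thesis
    unfolding regular_deriv_eq_regular by (subst regular_logs) simp
qed

text \<open>Both sides are determined by their logarithm-free parts: on the left-hand side \<open>\<zeta>\<^sup>k\<close> collects
  \<open>\<N>\<^sup>ia\<close> and \<open>\<N>\<^bsup>k-i\<^esup>b\<close>, and Leibniz's rule for \<open>\<N>\<^sup>k\<close> produces the same terms on the right.\<close>

lemma diagonal_regular_deriv:
  assumes \<alpha>: "\<alpha> \<in> CmodZ" and a: "a \<in> eigen \<alpha>" and annihilated: "\<And>l. a \<in> annihilated M ((\<N> ^^ l) b)"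
  shows "diagonal (regular_deriv M j a b v) \<gamma> k = Y (pr a (int M - 1 - int j) b) v \<gamma> k"
proof -
  let ?n = "int M - 1 - int j"
  have annihilated_pow: "(\<N> ^^ i) a \<in> annihilated M ((\<N> ^^ l) b)" for i l
    by (induction i) (simp_all add: annihilated annihilated_\<N>)
  have fin: "antidiag_finite (regular_deriv M j ((\<N> ^^ i) a) ((\<N> ^^ l) b) v)" for i l
    by (rule regular_deriv_antidiag_finite[OF local_of_order_annihilated[OF \<alpha> eigen_\<N>_pow[OF a] annihilated_pow]])
  have "diagonal (regular_deriv M j a b v) \<gamma> k = (\<Sum>i\<le>k. Sum_any (\<lambda>x. regular_deriv M j a b v x i (\<gamma> - x) (k - i)))"
    using fin[of 0 0] by (intro diagonal_sum) simp
  also have "\<dots> = (\<Sum>i\<le>k. sW ((-1) ^ k / fact k * of_nat (k choose i))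
      (Y (pr ((\<N> ^^ i) a) ?n ((\<N> ^^ (k - i)) b)) v \<gamma> 0))"
  proof (rule sum.cong[OF refl])
    fix i assume i: "i \<in> {..k}"
    let ?H = "regular_deriv M j ((\<N> ^^ i) a) ((\<N> ^^ (k - i)) b) v"
    have c: "(-1) ^ (i + (k - i)) / (fact i * fact (k - i)) = (-1) ^ k / fact k * (of_nat (k choose i) :: complex)"
      using i by (simp add: binomial_fact)
    have "Sum_any (\<lambda>x. regular_deriv M j a b v x i (\<gamma> - x) (k - i))
        = Sum_any (\<lambda>x. sW ((-1) ^ k / fact k * of_nat (k choose i)) (?H x 0 (\<gamma> - x) 0))"
      unfolding regular_deriv_logs[of M j a b v _ i _ "k - i"] c ..
    also have "\<dots> = sW ((-1) ^ k / fact k * of_nat (k choose i)) (diagonal ?H \<gamma> 0)"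
      unfolding diagonal_zero
      by (rule Sum_any_additive[symmetric])
        (simp_all add: W.scale_right_distrib antidiag_finite_term[OF fin])
    also have "diagonal ?H \<gamma> 0 = Y (pr ((\<N> ^^ i) a) ?n ((\<N> ^^ (k - i)) b)) v \<gamma> 0"
      by (rule diagonal_regular_deriv_zero_log[OF \<alpha> eigen_\<N>_pow[OF a] annihilated_pow])
    finally show "Sum_any (\<lambda>x. regular_deriv M j a b v x i (\<gamma> - x) (k - i))
        = sW ((-1) ^ k / fact k * of_nat (k choose i))
            (Y (pr ((\<N> ^^ i) a) ?n ((\<N> ^^ (k - i)) b)) v \<gamma> 0)" .
  qed
  also have "\<dots> = sW ((-1) ^ k / fact k) (Y ((\<N> ^^ k) (pr a ?n b)) v \<gamma> 0)"
    unfolding Leibniz linear_props(6)[OF Y_linear] linear_props(2)[OF Y_linear]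
    by (simp add: W.scale_sum_right)
  also have "\<dots> = Y (pr a ?n b) v \<gamma> k"
    by (rule Y_log_coefficient[symmetric])
  finally show ?thesis .
qed

definition computes_products :: "nat \<Rightarrow> 'v \<Rightarrow> 'v \<Rightarrow> bool" where
  "computes_products M a b \<longleftrightarrow> local_of_order M (Y a) (Y b) \<and>
     (\<forall>n v. W.product_from_order M n (regular M a b v) = Y (pr a n b) v)"

text \<open>By local nilpotency only finitely many pairs \<open>\<N>\<^sup>ka, \<N>\<^sup>lb\<close> matter.\<close>

lemma exists_annihilating_order: "\<exists>M0. \<forall>M\<ge>M0. \<forall>l. a \<in> annihilated M ((\<N> ^^ l) b)"
proof -
  obtain K where K: "\<forall>k\<ge>K. (\<N> ^^ k) a = 0"
    using \<N>_pow_vanishes by blast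
  obtain L where L: "\<forall>l\<ge>L. (\<N> ^^ l) b = 0"
    using \<N>_pow_vanishes by blast
  define t where "t k l = (SOME N. \<forall>n\<ge>N. pr ((\<N> ^^ k) a) n ((\<N> ^^ l) b) = 0)" for k l
  have t: "pr ((\<N> ^^ k) a) n ((\<N> ^^ l) b) = 0" if "n \<ge> t k l" for k l n
    using someI_ex[OF pr_truncation] that unfolding t_def by blast
  define T where "T = Max ((\<lambda>(k, l). nat (t k l)) ` ({..K} \<times> {..L}))"
  have "pr ((\<N> ^^ k) a) n ((\<N> ^^ l) b) = 0" if "n \<ge> int T" for k l n
  proof (cases "k \<le> K \<and> l \<le> L")
    case True
    then have "nat (t k l) \<le> T"
      unfolding T_def by (intro Max_ge image_eqI[of _ _ "(k, l)"]) simp_all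
    with that show ?thesis
      by (intro t) linarith
  next
    case False
    then have "(\<N> ^^ k) a = 0 \<or> (\<N> ^^ l) b = 0"
      using K L by auto
    then show ?thesis
      by (auto simp: linear_props(3)[OF pr_linear(1)] linear_props(3)[OF pr_linear(2)])
  qed
  then show ?thesis
    unfolding annihilated_def by (intro exI[of _ T] allI impI CollectI) simp
qed

lemma computes_products_eigen:
  assumes \<alpha>: "\<alpha> \<in> CmodZ" and a: "a \<in> eigen \<alpha>"
  shows "\<exists>M0. \<forall>M\<ge>M0. computes_products M a b"
proof -
  obtain M0 where M0: "\<And>M l. M \<ge> M0 \<Longrightarrow> a \<in> annihilated M ((\<N> ^^ l) b)"
    using exists_annihilating_order by blast
  have "computes_products M a b" if M: "M \<ge> M0" for M
    unfolding computes_products_def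
  proof (intro conjI allI)
    have annihilated: "a \<in> annihilated M b"
      using M0[OF M, of 0] by simp
    then show "local_of_order M (Y a) (Y b)"
      by (rule local_of_order_annihilated[OF \<alpha> a])
    fix n v
    show "W.product_from_order M n (regular M a b v) = Y (pr a n b) v"
    proof (cases "n < int M")
      case True
      define j where "j = nat (int M - 1 - n)"
      have n: "n = int M - 1 - int j"
        using True by (simp add: j_def)
      have "W.product_from_order M n (regular M a b v) = diagonal (regular_deriv M j a b v)"
        using True by (simp add: W.product_from_order_def regular_deriv_def j_def)
      also have "\<dots> = Y (pr a n b) v"
        unfolding n by (intro ext diagonal_regular_deriv[OF \<alpha> a M0[OF M]])
      finally show ?thesis .
    next
      case False
      then have "pr a n b = 0"
        by (intro annihilated_pr[OF annihilated]) simp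
      with False show ?thesis
        by (intro ext) (simp add: W.product_from_order_def)
    qed
  qed
  then show ?thesis by blast
qed

lemma mult_z12_funpow_linear:
  assumes "\<And>\<gamma>1 \<gamma>2. H \<gamma>1 k1 \<gamma>2 k2 = sW c (H1 \<gamma>1 k1 \<gamma>2 k2) + H2 \<gamma>1 k1 \<gamma>2 k2"
  shows "(mult_z12 ^^ M) H \<gamma>1 k1 \<gamma>2 k2
    = sW c ((mult_z12 ^^ M) H1 \<gamma>1 k1 \<gamma>2 k2) + (mult_z12 ^^ M) H2 \<gamma>1 k1 \<gamma>2 k2"
proof (induction M arbitrary: \<gamma>1 \<gamma>2)
  case 0
  show ?case by (simp add: assms)
next
  case (Suc M)
  have step: "(mult_z12 ^^ Suc M) K \<gamma>1 k1 \<gamma>2 k2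
      = (mult_z12 ^^ M) K (\<gamma>1 - 1) k1 \<gamma>2 k2 - (mult_z12 ^^ M) K \<gamma>1 k1 (\<gamma>2 - 1) k2" for K :: "'w ser2"
    by (simp add: mult_z12_def)
  show ?case
    unfolding step Suc by (simp add: W.scale_right_diff_distrib)
qed

text \<open>For a fixed order \<open>M\<close> both locality and the formula for the product are linear in the first
  field, whereas the least order of locality is not.\<close>

lemma computes_products_combination:
  assumes x: "computes_products M x b" and y: "computes_products M y b"
  shows "computes_products M (sV c x + y) b"
proof -
  let ?z = "sV c x + y"
  have loc_x: "local_of_order M (Y x) (Y b)" and loc_y: "local_of_order M (Y y) (Y b)"
    using x y by (simp_all add: computes_products_def)
  have loc: "local_of_order M (Y ?z) (Y b)"
    unfolding local_of_order_def
  proof (intro allI ext)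
    fix v \<gamma>1 k1 \<gamma>2 k2
    have "(mult_z12 ^^ M) (comp12 (Y ?z) (Y b) v) \<gamma>1 k1 \<gamma>2 k2
        = sW c ((mult_z12 ^^ M) (comp12 (Y x) (Y b) v) \<gamma>1 k1 \<gamma>2 k2)
          + (mult_z12 ^^ M) (comp12 (Y y) (Y b) v) \<gamma>1 k1 \<gamma>2 k2"
      by (rule mult_z12_funpow_linear) (simp add: comp12_def linear_props[OF Y_linear])
    also have "\<dots> = sW c ((mult_z12 ^^ M) (comp21 (Y b) (Y x) v) \<gamma>1 k1 \<gamma>2 k2)
          + (mult_z12 ^^ M) (comp21 (Y b) (Y y) v) \<gamma>1 k1 \<gamma>2 k2"
      using loc_x loc_y by (simp add: local_of_order_def)
    also have "\<dots> = (mult_z12 ^^ M) (comp21 (Y b) (Y ?z) v) \<gamma>1 k1 \<gamma>2 k2"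
      by (rule mult_z12_funpow_linear[symmetric])
        (simp add: comp21_def linear_props[OF Y_linear] linear_props[OF Y_linear_arg])
    finally show "(mult_z12 ^^ M) (comp12 (Y ?z) (Y b) v) \<gamma>1 k1 \<gamma>2 k2
        = (mult_z12 ^^ M) (comp21 (Y b) (Y ?z) v) \<gamma>1 k1 \<gamma>2 k2" .
  qed
  have "W.product_from_order M n (regular M ?z b v) = Y (pr ?z n b) v" for n v
  proof (cases "n < int M")
    case True
    define j where "j = nat (int M - 1 - n)"
    have prod: "W.product_from_order M n (regular M u b v) = diagonal (regular_deriv M j u b v)" for u
      using True by (simp add: W.product_from_order_def regular_deriv_def j_def)
    have diag: "diagonal (regular_deriv M j x b v) = Y (pr x n b) v" "diagonal (regular_deriv M j y b v) = Y (pr y n b) v"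
      using x y by (simp_all add: computes_products_def flip: prod)
    have "regular_deriv M j ?z b v = (\<lambda>\<gamma>1 k1 \<gamma>2 k2. sW c (regular_deriv M j x b v \<gamma>1 k1 \<gamma>2 k2) + regular_deriv M j y b v \<gamma>1 k1 \<gamma>2 k2)"
      by (intro ext) (simp add: regular_deriv_eq_regular linear_props[OF regular_linear]
          linear_props[OF V.op_choose_linear[OF shifted_\<N>_linear(2)]])
    then have "diagonal (regular_deriv M j ?z b v) \<gamma> k = sW c (diagonal (regular_deriv M j x b v) \<gamma> k) + diagonal (regular_deriv M j y b v) \<gamma> k"
      for \<gamma> k
      using regular_deriv_antidiag_finite[OF loc_x] regular_deriv_antidiag_finite[OF loc_y]
      by (simp add: diagonal_add W.antidiag_finite_scale W.diagonal_scale)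
    then show ?thesis
      unfolding prod
      by (intro ext) (simp add: diag linear_props[OF pr_linear(1)] linear_props[OF Y_linear])
  next
    case False
    then have "Y (pr x n b) v = (\<lambda>\<gamma> k. 0)" "Y (pr y n b) v = (\<lambda>\<gamma> k. 0)"
      using x y unfolding computes_products_def W.product_from_order_def by metis+
    then have "Y (pr ?z n b) v = (\<lambda>\<gamma> k. 0)"
      by (intro ext) (simp add: linear_props[OF pr_linear(1)] linear_props[OF Y_linear])
    with False show ?thesis
      by (simp add: W.product_from_order_def)
  qed
  with loc show ?thesis
    by (simp add: computes_products_def)
qed

lemma computes_products_eventually: "\<exists>M0. \<forall>M\<ge>M0. computes_products M a b"
proof -
  have "a \<in> V.span (\<Union>\<alpha>\<in>CmodZ. eigen \<alpha>)"
    by (simp add: span_eigen)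
  then show ?thesis
  proof (induction rule: V.span_induct_alt)
    case base
    have "{(x :: complex, y). x - y \<in> \<int>} `` {0} \<in> CmodZ"
      unfolding CmodZ_def by (rule quotientI) simp
    then show ?case
      by (rule computes_products_eigen[OF _ V.subspace_0[OF eigen_subspace]])
  next
    case (step c x y)
    then obtain \<alpha> where "\<alpha> \<in> CmodZ" "x \<in> eigen \<alpha>" by blast
    from computes_products_eigen[OF this] obtain M1 where "\<And>M. M \<ge> M1 \<Longrightarrow> computes_products M x b"
      by blast
    moreover from step(2) obtain M2 where "\<And>M. M \<ge> M2 \<Longrightarrow> computes_products M y b"
      by blast
    ultimately have "computes_products M (sV c x + y) b" if "M \<ge> max M1 M2" for M
      using that by (intro computes_products_combination) auto
    then show ?case by blast
  qed
qed

lemma Y_local: "local_pair (Y a) (Y b)"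
  using computes_products_eventually[of a b] unfolding computes_products_def local_pair_def by blast

lemma Y_product: "Y (pr a n b) = lprod sW (Y a) n (Y b)"
proof
  fix v
  obtain M where M: "computes_products M a b"
    using computes_products_eventually by blast
  then have "lprod sW (Y a) n (Y b) v = W.product_from_order M n (regular M a b v)"
    unfolding regular_def by (intro W.lprod_from_order Y_LFie) (simp add: computes_products_def)
  then show "Y (pr a n b) v = lprod sW (Y a) n (Y b) v"
    using M by (simp add: computes_products_def)
qed

end

theorem proposition5p5:
  fixes sV :: "complex \<Rightarrow> 'v::ab_group_add \<Rightarrow> 'v"
    and vac :: 'v
    and pr :: "'v \<Rightarrow> int \<Rightarrow> 'v \<Rightarrow> 'v"
    and \<phi> \<sigma> \<N> :: "'v \<Rightarrow> 'v"
    and sW :: "complex \<Rightarrow> 'w::ab_group_add \<Rightarrow> 'w"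
    and Y :: "'v \<Rightarrow> 'w lfield"
  assumes "vertex_algebra sV vac pr"
    and "\<phi> \<in> Aut_VA sV pr" and "locally_finite sV \<phi>"
    and "\<sigma> \<in> Aut_VA sV pr" and "semisimple_op sV \<sigma>"
    and "\<N> \<in> Der_VA sV pr" and "locally_nilpotent \<N>"
    and "\<sigma> \<circ> \<N> = \<N> \<circ> \<sigma>"
    and "\<phi> = \<sigma> \<circ> exp_op sV (- 2 * of_real pi * \<i>) \<N>"
    and "vector_space sW"
    and "linear_to_LFie sV sW Y"
    and "Y vac = id_field"
    and "equivariant sW \<phi> Y"
    and "twisted_borcherds sV pr \<sigma> \<N> sW Y"
  shows "twisted_module sV vac pr \<phi> sW Y"
proof -
  interpret twisted_borcherds_map sV vac pr \<sigma> \<N> sW Y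
    by (rule twisted_borcherds_map.intro) (use assms in simp_all)
  have "local_collection sW (range Y)"
    using Y_LFie Y_local by (auto simp: local_collection_def)
  with assms show ?thesis
    by (simp add: twisted_module_def Y_product)
qed

end
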